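(* Let $k>0$, $\sigma>0$, $p\in\mathbb{R}^2$ and $N_1,N_2\in\mathbb{N}$. There exists $\varepsilon_0>0$ such that for every $\varepsilon\in(0,\varepsilon_0)$ the self-dual system (SD) (see context) admits a field configuration $(a_1^{(i),\varepsilon},a_2^{(i),\varepsilon},\phi_i^{\varepsilon})$, $i=1,2$, where $p$ is the only zero of $\phi_i^{\varepsilon}$, with multiplicity $N_i$ ($i=1,2$), and $$|\phi_i^{\varepsilon}|^2=O(|x|^{-2\beta_i^{\varepsilon}}),\qquad |D_j\phi_i^{\varepsilon}|^2=O(|x|^{-2(\beta_i^{\varepsilon}+1)}),\qquad f_{12}^{(i),\varepsilon}=O(|x|^{-2\beta_i^{\varepsilon}}),\qquad\text{as }|x|\to\infty\quad(i,j=1,2),$$ with $\beta_1^{\varepsilon}=N_2+1+o(1)$ and $\beta_2^{\varepsilon}=N_1+1+o(1)$ as $\varepsilon\to0^+$. Furthermore, as $\varepsilon\to 0^+$: $$\frac{1}{2\pi}f_{12}^{(i),\varepsilon}\rightharpoonup (N_1+N_2+1)\delta_p\quad\text{weakly in the sense of measure in }\mathbb{R}^2\ (i=1,2),$$ $$f_{12}^{(1),\varepsilon}-f_{12}^{(2),\varepsilon}\to0\quad\text{in }L^1(\mathbb{R}^2).$$ In particular, as $\varepsilon\to0^+$: $$\frac1{2\pi}\Phi_{i,\varepsilon}=\frac{1}{2\pi}\int_{\mathbb{R}^2}f_{12}^{(i),\varepsilon}\,dx\to N_1+N_2+1\quad(i=1,2),$$ $$E_{\varepsilon}=\frac{N(N-1)\sigma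 k}{4\pi}\int_{\mathbb{R}^2}\left(f_{12}^{(1),\varepsilon}-f_{12}^{(2),\varepsilon}\right)dx\to0.$$
   Context: $\mathbb{N}$ denotes the positive integers; $N$ is the fixed integer giving the size of the gauge group $U(N)\times U(N)$. The unknowns are real-valued functions $a_1^{(i)},a_2^{(i)}$ and complex-valued functions $\phi_i$ on $\mathbb{R}^2$, $i=1,2$. Notation: $D_j\phi_i=\partial_j\phi_i-\mathrm{i}\,a_j^{(i)}\phi_i$ ($j=1,2$), $f_{12}^{(i)}=\partial_1a_2^{(i)}-\partial_2a_1^{(i)}$, and $c^2=\frac{\sigma k}{2\pi}$. The self-dual system (SD) on $\mathbb{R}^2$ is $$D_1\phi_1-\mathrm{i}D_2\phi_1=0,\qquad D_1\phi_2-\mathrm{i}D_2\phi_2=0,$$ $$f_{12}^{(1)}-\frac{8\pi^2}{k^2}|\phi_2|^2\left(|\phi_1|^2+c^2\right)=0,\qquad f_{12}^{(2)}-\frac{8\pi^2}{k^2}|\phi_1|^2\left(|\phi_2|^2-c^2\right)=0.$$ A zero $p$ of $\phi_i$ has multiplicity $N_i$ if $|\phi_i(x)|\,|x-p|^{-N_i}$ extends to a continuous positive function near $p$. $\Phi_i=\int_{\mathbb{R}^2}f_{12}^{(i)}dx$ is the total flux, and $E=\frac{N(N-1)\sigma k}{4\pi}\int_{\mathbb{R}^2}(f_{12}^{(1)}-f_{12}^{(2)})dx$ is the total energy of a solution of (SD). $\delta_p$ is the Dirac mass at $p$. The superscript/subscript $\varepsilon$ indicates quantities computed for the configuration with parameter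 $\varepsilon$.
   Formalization: Here D_j = ∂_j + i a_j, not ∂_j − i a_j (with the printed sign ln|φ_1| is subharmonic, so φ_1 cannot decay), and f_12^(1) = O(|x|^{-2β_2}), f_12^(2) = O(|x|^{-2β_1}), exponents exchanged, since the printed bounds fail if N_1 ≠ N_2. *)

theory Defs
  imports "HOL-Analysis.Analysis" "HOL-Library.Landau_Symbols"
begin

text \<open>
  The plane is \<open>real^2\<close>. The index type \<open>2\<close> serves both for the space directions \<open>j\<close> and for the
  two species \<open>i\<close>; in this type the numeral \<open>2\<close> denotes the same element as \<open>0\<close>, and \<open>1 \<noteq> 2\<close>.
  A gauge potential of one species is \<open>A :: 2 \<Rightarrow> real^2 \<Rightarrow> real\<close>, and a configuration is a pair
  \<open>(a, \<phi>)\<close> with \<open>a i j\<close> standing for \<open>a\<^sub>j\<close> of species \<open>i\<close>.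
\<close>

definition partial_deriv :: "2 \<Rightarrow> (real^2 \<Rightarrow> 'b::real_normed_vector) \<Rightarrow> real^2 \<Rightarrow> 'b" where
  "partial_deriv j f x = frechet_derivative f (at x) (axis j 1)"

definition C1_on_plane :: "(real^2 \<Rightarrow> 'b::real_normed_vector) \<Rightarrow> bool" where
  "C1_on_plane f \<longleftrightarrow>
     (\<forall>x. f differentiable (at x)) \<and> (\<forall>j. continuous_on UNIV (partial_deriv j f))"

text \<open>
  Sign convention. The sources write \<open>D\<^sub>j \<phi> = \<partial>\<^sub>j \<phi> - \<i> a\<^sub>j \<phi>\<close>. With that sign, the equations
  \<open>D\<^sub>1 \<phi> - \<i> D\<^sub>2 \<phi> = 0\<close> give \<open>\<Delta> ln |\<phi>| = + f\<^sub>1\<^sub>2\<close> away from the zeros. Since \<open>f\<^sub>1\<^sub>2 > 0\<close> for the first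
  species wherever the second field does not vanish, \<open>|\<phi>\<^sub>1|\<close> then has no positive local maximum,
  hence cannot decay at infinity. The decay rates and fluxes of the theorem belong to
  \<open>\<Delta> ln |\<phi>| = - f\<^sub>1\<^sub>2\<close>, which holds for the coupling \<open>\<partial>\<^sub>j + \<i> a\<^sub>j\<close> used here. Keeping \<open>\<partial>\<^sub>j - \<i> a\<^sub>j\<close> and
  imposing \<open>D\<^sub>1 \<phi> + \<i> D\<^sub>2 \<phi> = 0\<close> instead is the same thing after replacing \<open>\<phi>\<close> by its complex
  conjugate, with \<open>a\<close>, \<open>|\<phi>|\<close>, \<open>|D\<^sub>j \<phi>|\<close> and \<open>f\<^sub>1\<^sub>2\<close> unchanged.
\<close>

definition cov_deriv ::
  "(2 \<Rightarrow> real^2 \<Rightarrow> real) \<Rightarrow> 2 \<Rightarrow> (real^2 \<Rightarrow> complex) \<Rightarrow> real^2 \<Rightarrow> complex" where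
  "cov_deriv A j \<phi> x = partial_deriv j \<phi> x + \<i> * complex_of_real (A j x) * \<phi> x"

definition curvature :: "(2 \<Rightarrow> real^2 \<Rightarrow> real) \<Rightarrow> real^2 \<Rightarrow> real" where
  "curvature A x = partial_deriv 1 (A 2) x - partial_deriv 2 (A 1) x"

definition c_squared :: "real \<Rightarrow> real \<Rightarrow> real" where
  "c_squared k \<sigma> = \<sigma> * k / (2 * pi)"

text \<open>
  Classical solutions: all fields are of class \<open>C\<^sup>1\<close>, so that every term is continuous. At infinity,
  where both fields tend to zero, the curvature of each species has the order of \<open>|\<phi>|\<^sup>2\<close> of the
  \<^emph>\<open>other\<close> species; this is why the theorem bounds the curvature of species \<open>1\<close> by the exponent
  \<open>\<beta>\<close> of species \<open>2\<close> and vice versa. Bounding it by the exponent of its own species, as the sources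
  do, is incompatible with the limits of \<open>\<beta>\<close> and of the fluxes when \<open>N1 \<noteq> N2\<close>.
\<close>

definition self_dual_solution ::
  "real \<Rightarrow> real \<Rightarrow> (2 \<Rightarrow> 2 \<Rightarrow> real^2 \<Rightarrow> real) \<Rightarrow> (2 \<Rightarrow> real^2 \<Rightarrow> complex) \<Rightarrow> bool" where
  "self_dual_solution k \<sigma> a \<phi> \<longleftrightarrow>
     (\<forall>i. C1_on_plane (\<phi> i)) \<and> (\<forall>i j. C1_on_plane (a i j)) \<and>
     (\<forall>x. cov_deriv (a 1) 1 (\<phi> 1) x - \<i> * cov_deriv (a 1) 2 (\<phi> 1) x = 0) \<and>
     (\<forall>x. cov_deriv (a 2) 1 (\<phi> 2) x - \<i> * cov_deriv (a 2) 2 (\<phi> 2) x = 0) \<and>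
     (\<forall>x. curvature (a 1) x
            - 8 * pi^2 / k^2 * (norm (\<phi> 2 x))^2 * ((norm (\<phi> 1 x))^2 + c_squared k \<sigma>) = 0) \<and>
     (\<forall>x. curvature (a 2) x
            - 8 * pi^2 / k^2 * (norm (\<phi> 1 x))^2 * ((norm (\<phi> 2 x))^2 - c_squared k \<sigma>) = 0)"

definition has_zero_of_mult :: "(real^2 \<Rightarrow> complex) \<Rightarrow> real^2 \<Rightarrow> nat \<Rightarrow> bool" where
  "has_zero_of_mult \<phi> p n \<longleftrightarrow>
     \<phi> p = 0 \<and>
     (\<exists>U g. open U \<and> p \<in> U \<and> continuous_on U g \<and> (\<forall>x\<in>U. (g x :: real) > 0) \<and>
            (\<forall>x\<in>U - {p}. norm (\<phi> x) / norm (x - p) ^ n = g x))"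

definition total_flux :: "(2 \<Rightarrow> real^2 \<Rightarrow> real) \<Rightarrow> real" where
  "total_flux A = (LINT x|lborel. curvature A x)"

definition total_energy ::
  "nat \<Rightarrow> real \<Rightarrow> real \<Rightarrow> (2 \<Rightarrow> 2 \<Rightarrow> real^2 \<Rightarrow> real) \<Rightarrow> real" where
  "total_energy N k \<sigma> a =
     real N * (real N - 1) * \<sigma> * k / (4 * pi) *
       (LINT x|lborel. curvature (a 1) x - curvature (a 2) x)"

text \<open>
  Weak convergence of the (signed) measures with Lebesgue densities \<open>g \<epsilon>\<close> to \<open>m\<close> times the Dirac mass
  at \<open>p\<close>, tested against bounded continuous functions, so that no mass escapes to infinity.
\<close>

definition weakly_tendsto_dirac ::
  "('e \<Rightarrow> real^2 \<Rightarrow> real) \<Rightarrow> real \<Rightarrow> real^2 \<Rightarrow> 'e filter \<Rightarrow> bool" where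
  "weakly_tendsto_dirac g m p F \<longleftrightarrow>
     (\<forall>\<psi> :: real^2 \<Rightarrow> real. continuous_on UNIV \<psi> \<and> bounded (range \<psi>) \<longrightarrow>
        ((\<lambda>\<epsilon>. LINT x|lborel. g \<epsilon> x * \<psi> x) \<longlongrightarrow> m * \<psi> p) F)"

end

theory Submission
  imports Defs
begin

text \<open>
  Radial configurations \<open>\<phi>\<^sub>i = A\<^sub>i (cnj z)\<^bsup>Ni\<^esup> exp h\<^sub>i\<close>, \<open>a = (\<partial>\<^sub>2 h, - \<partial>\<^sub>1 h)\<close> around \<open>p\<close> solve the first
  two equations identically and have curvature \<open>- \<Delta> h\<^sub>i\<close>. With \<open>t = |x - p|\<^sup>2 / \<epsilon>\<^sup>2\<close>, \<open>M = N1 + N2 + 1\<close> and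
  \<open>|\<phi>\<^sub>i|\<^sup>2\<close> of order \<open>1 / \<epsilon>\<close>, the remaining equations become an \<open>O(\<epsilon>)\<close> perturbation of the singular
  Liouville equation, whose solution is \<open>h\<^sub>i = - ln (1 + t^M) / 2\<close>. The corrections \<open>g\<^sub>i\<close> satisfy a
  Volterra equation on \<open>[0, \<infinity>)\<close>, \<open>(t g\<^sub>i')' = f\<^sub>i\<close> with \<open>g\<^sub>i(0) = 0\<close>, solved by a contraction in a
  polynomially weighted space, and \<open>|f\<^sub>i| \<le> \<eta>(\<epsilon>) (1 + t)\<^bsup>-5/4\<^esup>\<close> with \<open>\<eta>(\<epsilon>) \<longrightarrow> 0\<close>. Hence
  \<open>|g\<^sub>i| \<le> \<eta>(\<epsilon>) ln (1 + t)\<close>, which moves the decay exponents by \<open>O(\<eta>)\<close> only, and the rescaled curvatures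
  converge under an integrable majorant to the Liouville density, of mass \<open>2 \<pi> M\<close>. The difference of
  the curvatures is nonnegative, so its \<open>L\<^sup>1\<close> norm equals the difference of the fluxes.
\<close>

subsection \<open>A Volterra equation on the half line\<close>

text \<open>Fluxes and decay rates are prescribed only in the limit, so the corrections may be
  started at the origin as a Cauchy problem with no condition to match at infinity; the kernel of
  the linearised Liouville operator is then no obstruction. Scale: if \<open>|phi_i|^2\<close> has
  order \<open>1 / \<epsilon>\<close>, the quartic term of the curvature equations has order
  \<open>1 / \<epsilon>^2\<close>, like the Laplacian in the variable \<open>t\<close>, while the
  \<open>c^2\<close> term has order \<open>1 / \<epsilon>\<close> and is smaller by a factor
  \<open>\<epsilon>\<close>. The product of the two squared moduli is proportional to
  \<open>t ^ (N1 + N2) / (1 + t ^ M)^2\<close>, whence one profile for both species; each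
  \<open>|phi_i|^2\<close> falls like \<open>t\<close> to the power \<open>Ni - M\<close>, which is
  the origin of \<open>N2 + 1\<close> and \<open>N1 + 1\<close>. The obstacle is that the
  contraction works only in a space of fast growing functions, whereas decay is wanted up to
  infinity. The exponents pay for this: the coefficients decay with exponent 2, clipping costs 1/2
  and interpolation 1/4, and the remaining 5/4 still exceeds 1, the threshold of
  integrability.\<close>

lemma continuous_on_average:
  fixes f :: "real \<Rightarrow> 'a::banach"
  assumes "continuous_on {0..} f"
  shows "continuous_on {0..} (\<lambda>s. integral {0..1} (\<lambda>\<theta>. f (s * \<theta>)))"
proof -
  have "continuous_on ({0..} \<times> cbox 0 1) (\<lambda>(s, \<theta>). f (s * \<theta>))"
    unfolding case_prod_beta
    by (intro continuous_on_compose2[OF assms] continuous_intros) auto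
  from integral_continuous_on_param[OF this] show ?thesis
    by simp
qed

lemma has_vector_derivative_integral_from_0:
  fixes f :: "real \<Rightarrow> 'a::banach"
  assumes "continuous_on {0..} f" "t \<ge> 0"
  shows "((\<lambda>t. integral {0..t} f) has_vector_derivative f t) (at t within {0..})"
proof -
  have "continuous_on {0..t + 1} f"
    by (rule continuous_on_subset[OF assms(1)]) auto
  from integral_has_vector_derivative[OF this, of t]
  have "((\<lambda>t. integral {0..t} f) has_vector_derivative f t) (at t within {0..t + 1})"
    using assms(2) by simp
  moreover have "at t within {0..t + 1} = at t within {0..}"
    by (rule at_within_nhd[of _ "{..<t + 1}"]) auto
  ultimately show ?thesis by simp
qed

text \<open>The average over \<open>{0..1}\<close> is \<open>1 / s\<close> times the integral of
  \<open>f\<close> over \<open>{0..s}\<close>, in a form that makes sense at \<open>s = 0\<close>;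
  the double integral is thus the solution of \<open>(t g')' = f\<close> that is regular and zero at
  the origin. Averaging does not enlarge a nondecreasing bound, and the outer integration
  contributes the factor \<open>1 / Suc m\<close>, from which the contraction constant gets its
  smallness.\<close>

lemma norm_double_integral_le:
  fixes f :: "real \<Rightarrow> 'a::banach"
  assumes f: "continuous_on {0..} f"
    and le: "\<And>s. s \<ge> 0 \<Longrightarrow> norm (f s) \<le> D * (1 + s) ^ m"
    and "t \<ge> 0"
  shows "norm (integral {0..t} (\<lambda>s. integral {0..1} (\<lambda>\<theta>. f (s * \<theta>))))
           \<le> D / real (Suc m) * (1 + t) ^ Suc m"
proof -
  let ?J = "\<lambda>s. integral {0..1} (\<lambda>\<theta>. f (s * \<theta>))"
  have D: "D \<ge> 0" using le[of 0] order_trans[OF norm_ge_zero] by force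
  have J: "norm (?J s) \<le> D * (1 + s) ^ m" if "s \<ge> 0" for s
  proof -
    have "norm (?J s) \<le> integral {0..1} (\<lambda>\<theta>::real. D * (1 + s) ^ m)"
    proof (rule Henstock_Kurzweil_Integration.integral_norm_bound_integral)
      show "(\<lambda>\<theta>. f (s * \<theta>)) integrable_on {0..1}"
        by (intro integrable_continuous_real continuous_on_compose2[OF f] continuous_intros)
           (use that in auto)
      fix \<theta> :: real assume th: "\<theta> \<in> {0..1}"
      have "norm (f (s * \<theta>)) \<le> D * (1 + s * \<theta>) ^ m"
        using that th by (intro le) auto
      also have "\<dots> \<le> D * (1 + s) ^ m"
        using that th D by (intro mult_left_mono power_mono) (auto simp: mult_left_le)
      finally show "norm (f (s * \<theta>)) \<le> D * (1 + s) ^ m" .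
    qed auto
    then show ?thesis by simp
  qed
  have ftc: "((\<lambda>s. D * (1 + s) ^ m) has_integral
     (D / real (Suc m) * (1 + t) ^ Suc m - D / real (Suc m) * (1 + 0) ^ Suc m)) {0..t}"
  proof (rule fundamental_theorem_of_calculus[OF \<open>t \<ge> 0\<close>])
    fix s assume "s \<in> {0..t}"
    have "((\<lambda>s. D / real (Suc m) * (1 + s) ^ Suc m) has_real_derivative
            D / real (Suc m) * (real (Suc m) * (1 + s) ^ m)) (at s within {0..t})"
      by (auto intro!: derivative_eq_intros simp del: power_Suc)
    then show "((\<lambda>s. D / real (Suc m) * (1 + s) ^ Suc m) has_vector_derivative D * (1 + s) ^ m)
                 (at s within {0..t})"
      by (simp add: has_real_derivative_iff_has_vector_derivative)
  qed
  have "norm (integral {0..t} ?J) \<le> integral {0..t} (\<lambda>s. D * (1 + s) ^ m)"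
    by (rule Henstock_Kurzweil_Integration.integral_norm_bound_integral)
       (auto intro!: integrable_continuous_real continuous_on_subset[OF continuous_on_average[OF f]]
                     J continuous_intros)
  also have "\<dots> = D / real (Suc m) * (1 + t) ^ Suc m - D / real (Suc m)"
    using integral_unique[OF ftc] by simp
  also have "\<dots> \<le> D / real (Suc m) * (1 + t) ^ Suc m"
    using D by simp
  finally show ?thesis .
qed

text \<open>
  The contraction principle applies on the whole half line because, for the weight \<open>(1 + t)^n\<close>,
  the Volterra operator has Lipschitz constant \<open>L / n\<close>.
\<close>

lemma volterra_fixpoint:
  fixes G :: "real \<Rightarrow> 'a::banach \<Rightarrow> 'a"
  assumes G: "continuous_on ({0..} \<times> UNIV) (\<lambda>(t, u). G t u)"
    and lip: "\<And>t u v. t \<ge> 0 \<Longrightarrow> norm (G t u - G t v) \<le> L / (1 + t) * norm (u - v)"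
    and G0: "\<And>t. t \<ge> 0 \<Longrightarrow> norm (G t 0) \<le> C"
    and "L \<ge> 0"
    and m: "2 * L \<le> real (Suc m)"
  shows "\<exists>g. continuous_on {0..} g \<and>
     (\<forall>t\<ge>0. g t = integral {0..t} (\<lambda>s. integral {0..1} (\<lambda>\<theta>. G (s * \<theta>) (g (s * \<theta>))))) \<and>
     (\<forall>t\<ge>0. norm (g t) \<le> 2 * C * (1 + t) ^ Suc m)"
proof -
  define n where "n = Suc m"
  \<comment> \<open>The unknown \<open>u\<close> is a bounded continuous function and
    \<open>W u\<close> the candidate solution, so the sup norm of \<open>u\<close> is a weighted
    norm. Since \<open>u\<close> is defined on the whole line, \<open>max 0 t\<close> in
    \<open>S\<close> extends the values on the half line constantly to the left.\<close>
  define W :: "(real \<Rightarrow>\<^sub>C 'a) \<Rightarrow> real \<Rightarrow> 'a" where "W u t = ((1 + t) ^ n) *\<^sub>R u t" for u t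
  define F where "F u t = G t (W u t)" for u t
  define T where "T u t = integral {0..t} (\<lambda>s. integral {0..1} (\<lambda>\<theta>. F u (s * \<theta>)))" for u t
  define S where "S u t = (1 / (1 + max 0 t) ^ n) *\<^sub>R T u (max 0 t)" for u t
  have L0: "L \<ge> 0" by fact
  have C0: "C \<ge> 0" using order_trans[OF norm_ge_zero G0[of 0]] by simp
  have contW: "continuous_on A (W u)" for u A
    unfolding W_def by (intro continuous_intros) auto
  have contF: "continuous_on {0..} (F u)" for u
    using continuous_on_compose2[OF G, of "{0..}" "\<lambda>t. (t, W u t)"]
    unfolding F_def by (force intro!: continuous_intros contW)
  have contT: "continuous_on {0..} (T u)" for u
  proof -
    have "(T u has_vector_derivative integral {0..1} (\<lambda>\<theta>. F u (t * \<theta>))) (at t within {0..})"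
      if "t \<ge> 0" for t
      unfolding T_def using has_vector_derivative_integral_from_0[OF continuous_on_average[OF contF] that] .
    then show ?thesis
      by (auto simp: continuous_on_eq_continuous_within intro: has_vector_derivative_continuous)
  qed
  have contS: "continuous_on UNIV (S u)" for u
    unfolding S_def
    by (intro continuous_intros continuous_on_compose2[OF contT]) (auto simp: add_nonneg_eq_0_iff)
  have dW: "norm (W u t - W v t) \<le> (1 + t) ^ n * dist u v" if "t \<ge> 0" for u v t
  proof -
    have "norm (W u t - W v t) = (1 + t) ^ n * dist (u t) (v t)"
      using that by (simp add: W_def dist_norm flip: scaleR_diff_right)
    also have "\<dots> \<le> (1 + t) ^ n * dist u v"
      using that by (intro mult_left_mono dist_bounded) auto
    finally show ?thesis .
  qed
  \<comment> \<open>The decay \<open>1 / (1 + t)\<close> of the Lipschitz constant cancels one of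
    the \<open>n = Suc m\<close> powers of the weight; the integration in \<open>T\<close> restores
    it and leaves the gain \<open>1 / n\<close>.\<close>
  have dF: "norm (F u t - F v t) \<le> L * dist u v * (1 + t) ^ m" if "t \<ge> 0" for u v t
  proof -
    have "norm (F u t - F v t) \<le> L / (1 + t) * norm (W u t - W v t)"
      unfolding F_def using that by (rule lip)
    also have "\<dots> \<le> L / (1 + t) * ((1 + t) ^ n * dist u v)"
      using that L0 by (intro mult_left_mono dW) auto
    also have "\<dots> = L * dist u v * (1 + t) ^ m"
      using that by (simp add: n_def field_simps)
    finally show ?thesis .
  qed
  have F0: "norm (F 0 t) \<le> C * (1 + t) ^ m" if "t \<ge> 0" for t
  proof -
    have "norm (F 0 t) \<le> C * 1" using G0[OF that] by (simp add: F_def W_def)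
    also have "\<dots> \<le> C * (1 + t) ^ m" using that C0 by (intro mult_left_mono) auto
    finally show ?thesis .
  qed
  have dT: "norm (T u t - T v t) \<le> L * dist u v / real n * (1 + t) ^ n" if "t \<ge> 0" for u v t
  proof -
    have int: "(\<lambda>\<theta>. F u (s * \<theta>)) integrable_on {0..1}" if "s \<ge> 0" for s u
      by (intro integrable_continuous_real continuous_on_compose2[OF contF] continuous_intros)
         (use that in auto)
    have "T u t - T v t = integral {0..t} (\<lambda>s. integral {0..1} (\<lambda>\<theta>. F u (s * \<theta>)) -
             integral {0..1} (\<lambda>\<theta>. F v (s * \<theta>)))"
      unfolding T_def
      by (intro Henstock_Kurzweil_Integration.integral_diff[symmetric] integrable_continuous_real
                continuous_on_subset[OF continuous_on_average[OF contF]]) auto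
    also have "\<dots> = integral {0..t} (\<lambda>s. integral {0..1} (\<lambda>\<theta>. F u (s * \<theta>) - F v (s * \<theta>)))"
      by (intro Henstock_Kurzweil_Integration.integral_cong Henstock_Kurzweil_Integration.integral_diff[symmetric] int) auto
    finally show ?thesis
      using norm_double_integral_le[of "\<lambda>t. F u t - F v t" "L * dist u v" m t] that
      by (simp add: n_def dF continuous_intros contF)
  qed
  have bT: "norm (T 0 t) \<le> C / real n * (1 + t) ^ n" if "t \<ge> 0" for t
    unfolding n_def T_def by (rule norm_double_integral_le) (use that contF F0 in auto)
  have half: "L * d / real n \<le> d / 2" if "d \<ge> 0" for d
    using mult_right_mono[OF m that] by (simp add: n_def field_simps)
  have dS: "dist (S u t) (S v t) \<le> 1/2 * dist u v" for u v t
  proof -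
    let ?t = "max 0 t"
    have "dist (S u t) (S v t) = norm (T u ?t - T v ?t) / (1 + ?t) ^ n"
      by (simp add: S_def dist_norm divide_inverse mult.commute flip: scaleR_diff_right)
    also have "\<dots> \<le> (L * dist u v / real n * (1 + ?t) ^ n) / (1 + ?t) ^ n"
      by (intro divide_right_mono dT) auto
    also have "\<dots> = L * dist u v / real n" by simp
    also have "\<dots> \<le> dist u v / 2" by (rule half) simp
    finally show ?thesis by simp
  qed
  have nS0: "norm (S 0 t) \<le> C / real n" for t
  proof -
    let ?t = "max 0 t"
    have "norm (S 0 t) = norm (T 0 ?t) / (1 + ?t) ^ n" by (simp add: S_def)
    also have "\<dots> \<le> (C / real n * (1 + ?t) ^ n) / (1 + ?t) ^ n"
      by (intro divide_right_mono bT) auto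
    finally show ?thesis by simp
  qed
  have nS: "norm (S u t) \<le> C + 1/2 * norm u" for u t
  proof -
    have "norm (S u t) \<le> norm (S 0 t) + dist (S u t) (S 0 t)"
      by (metis add.commute dist_norm norm_triangle_sub)
    also have "\<dots> \<le> C / real n + 1/2 * dist u 0"
      by (intro add_mono nS0 dS)
    also have "C / real n \<le> C / 1"
      using C0 by (intro divide_left_mono) (auto simp: n_def)
    finally show ?thesis by (simp add: dist_norm)
  qed
  have SB: "S u \<in> bcontfun" for u
    unfolding bcontfun_def using contS nS by (auto intro!: boundedI)
  have "\<exists>!u. Bcontfun (S u) = u"
  proof (rule banach_fix_type[where c = "1/2"])
    show "\<forall>u v. dist (Bcontfun (S u)) (Bcontfun (S v)) \<le> 1/2 * dist u v"
      by (intro allI dist_bound) (simp only: Bcontfun_inverse SB dS)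
  qed auto
  then obtain u where "Bcontfun (S u) = u" by blast
  then have u: "u t = S u t" for t using Bcontfun_inverse[OF SB] by metis
  \<comment> \<open>A priori bound: \<open>norm u \<le> C + norm u / 2\<close> yields
    \<open>norm u \<le> 2 * C\<close>, so the solution is as small as the source at zero.\<close>
  have nu: "norm u \<le> C + 1/2 * norm u"
    by (subst norm_conv_dist, rule dist_bound) (use u nS in \<open>auto simp: dist_norm\<close>)
  have gT: "W u t = T u t" if "t \<ge> 0" for t
    using that by (subst W_def, subst u) (simp add: S_def)
  show ?thesis
  proof (intro exI[of _ "W u"] conjI allI impI)
    fix t :: real assume t: "t \<ge> 0"
    show "W u t = integral {0..t} (\<lambda>s. integral {0..1} (\<lambda>\<theta>. G (s * \<theta>) (W u (s * \<theta>))))"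
      using gT[OF t] by (simp add: T_def F_def)
    have "norm (W u t) = (1 + t) ^ n * norm (u t)" using t by (simp add: W_def)
    also have "\<dots> \<le> (1 + t) ^ n * (2 * C)"
      using t nu norm_bounded[of u t] by (intro mult_left_mono) auto
    finally show "norm (W u t) \<le> 2 * C * (1 + t) ^ Suc m" by (simp add: n_def mult.commute)
  qed (rule contW)
qed

subsection \<open>Perturbation of the radial Liouville equation\<close>

definition source :: "real \<Rightarrow> real \<Rightarrow> real \<Rightarrow> real \<times> real \<Rightarrow> real \<times> real" where
  "source A B1 B2 u =
     (- A * (exp (2 * fst u + 2 * snd u) - 1) - B2 * exp (2 * snd u),
      - A * (exp (2 * fst u + 2 * snd u) - 1) + B1 * exp (2 * fst u))"

text \<open>
  Clipping the unknowns from above makes the exponential source globally Lipschitz, with a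
  decaying constant if the level grows like \<open>ln (1 + t) / 8\<close>. For small \<open>\<epsilon>\<close> the solution of the
  clipped problem stays below that level, so it solves the original one.
\<close>

definition clip :: "real \<Rightarrow> real \<times> real \<Rightarrow> real \<times> real" where
  "clip c u = (min (fst u) c, min (snd u) c)"

section \<open>Lipschitz and size estimates for the exponential source\<close>

lemma abs_exp_diff_le:
  fixes x y c :: real
  assumes "x \<le> c" "y \<le> c"
  shows "\<bar>exp x - exp y\<bar> \<le> exp c * \<bar>x - y\<bar>"
proof -
  have *: "exp x - exp y \<le> exp c * (x - y)" if "y \<le> x" "x \<le> c" for x y :: real
  proof -
    have "exp x - exp y = exp x * (1 - exp (y - x))" by (simp add: right_diff_distrib flip: exp_add)
    also have "1 - exp (y - x) \<le> x - y" using exp_ge_add_one_self[of "y - x"] by linarith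
    then have "exp x * (1 - exp (y - x)) \<le> exp x * (x - y)" by (intro mult_left_mono) auto
    also have "\<dots> \<le> exp c * (x - y)" using that by (intro mult_right_mono) auto
    finally show ?thesis .
  qed
  show ?thesis
    using *[of x y] *[of y x] assms by (cases "y \<le> x") (auto simp: abs_if)
qed

lemma abs_fst_le: "\<bar>fst u\<bar> \<le> norm u" for u :: "real \<times> real"
  by (cases u) (metis fst_conv norm_fst_le real_norm_def)

lemma abs_snd_le: "\<bar>snd u\<bar> \<le> norm u" for u :: "real \<times> real"
  by (cases u) (metis snd_conv norm_snd_le real_norm_def)

lemma norm_clip_diff_le: "norm (clip c u - clip c v) \<le> norm (u - v)"
  unfolding clip_def norm_prod_def
  by (intro real_sqrt_le_mono add_mono power_mono) (auto simp: min_def abs_if)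

text \<open>The largest exponent is \<open>2 * fst u + 2 * snd u \<le> 4 * c\<close>; its term
  occurs in both components with Lipschitz constant 4, hence \<open>8 * A\<close>. The factor
  \<open>exp (4 * c)\<close> is a small power of \<open>1 + t\<close> once \<open>c\<close> is a
  small multiple of \<open>ln (1 + t)\<close>.\<close>

lemma norm_source_diff_le:
  assumes u: "fst u \<le> c" "snd u \<le> c" and v: "fst v \<le> c" "snd v \<le> c" and "c \<ge> 0"
    and A: "A \<ge> 0" "B1 \<ge> 0" "B2 \<ge> 0"
  shows "norm (source A B1 B2 u - source A B1 B2 v)
           \<le> exp (4 * c) * (8 * A + 2 * B1 + 2 * B2) * norm (u - v)"
proof -
  define d where "d = norm (u - v)"
  have d: "\<bar>fst u - fst v\<bar> \<le> d" "\<bar>snd u - snd v\<bar> \<le> d" "d \<ge> 0"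
    using abs_fst_le[of "u - v"] abs_snd_le[of "u - v"] by (auto simp: d_def)
  have c: "exp (2 * c) \<le> exp (4 * c)" using \<open>c \<ge> 0\<close> by simp
  have 1: "\<bar>exp (2 * fst u + 2 * snd u) - exp (2 * fst v + 2 * snd v)\<bar> \<le> exp (4 * c) * (4 * d)"
    (is "\<bar>?e\<bar> \<le> _")
  proof -
    have "\<bar>?e\<bar> \<le> exp (4 * c) * \<bar>(2 * fst u + 2 * snd u) - (2 * fst v + 2 * snd v)\<bar>"
      using u v by (intro abs_exp_diff_le) auto
    also have "\<dots> \<le> exp (4 * c) * (4 * d)"
      using d by (intro mult_left_mono) (auto simp: abs_if split: if_splits)
    finally show ?thesis .
  qed
  have 2: "\<bar>exp (2 * x) - exp (2 * y)\<bar> \<le> exp (4 * c) * (2 * d)"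
    if "x \<le> c" "y \<le> c" "\<bar>x - y\<bar> \<le> d" for x y
  proof -
    have "\<bar>exp (2 * x) - exp (2 * y)\<bar> \<le> exp (2 * c) * \<bar>2 * x - 2 * y\<bar>"
      using that by (intro abs_exp_diff_le) auto
    also have "\<dots> \<le> exp (4 * c) * (2 * d)"
      using that c by (intro mult_mono) auto
    finally show ?thesis .
  qed
  have "norm (source A B1 B2 u - source A B1 B2 v) \<le>
     \<bar>- A * ?e - B2 * (exp (2 * snd u) - exp (2 * snd v))\<bar> +
     \<bar>- A * ?e + B1 * (exp (2 * fst u) - exp (2 * fst v))\<bar>"
    unfolding source_def diff_Pair
    by (rule order_trans[OF norm_Pair_le]) (simp add: algebra_simps)
  also have "\<dots> \<le> (\<bar>A * ?e\<bar> + \<bar>B2 * (exp (2 * snd u) - exp (2 * snd v))\<bar>) +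
      (\<bar>A * ?e\<bar> + \<bar>B1 * (exp (2 * fst u) - exp (2 * fst v))\<bar>)"
    by (intro add_mono) auto
  also have "\<dots> \<le> (A * (exp (4 * c) * (4 * d)) + B2 * (exp (4 * c) * (2 * d))) +
      (A * (exp (4 * c) * (4 * d)) + B1 * (exp (4 * c) * (2 * d)))"
    unfolding abs_mult abs_of_nonneg[OF A(1)] abs_of_nonneg[OF A(2)] abs_of_nonneg[OF A(3)]
    by (intro add_mono mult_left_mono 1 2 u v d A)
  also have "\<dots> = exp (4 * c) * (8 * A + 2 * B1 + 2 * B2) * d" by (simp add: algebra_simps)
  finally show ?thesis by (simp add: d_def)
qed

lemma norm_source_le:
  assumes u: "fst u \<le> c" "snd u \<le> c" and "c \<ge> 0"
    and A: "A \<ge> 0" "B1 \<ge> 0" "B2 \<ge> 0"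
  shows "norm (source A B1 B2 u) \<le> exp (4 * c) * (2 * A + B1 + B2)"
proof -
  let ?e = "exp (2 * fst u + 2 * snd u) - 1"
  have c: "1 \<le> exp (4 * c)" using \<open>c \<ge> 0\<close> by simp
  have "exp (2 * fst u + 2 * snd u) \<le> exp (4 * c)" using u by simp
  then have 1: "\<bar>?e\<bar> \<le> exp (4 * c)"
    using c exp_gt_zero[of "2 * fst u + 2 * snd u"] by linarith
  have 2: "exp (2 * x) \<le> exp (4 * c)" if "x \<le> c" for x using that \<open>c \<ge> 0\<close> by simp
  have "norm (source A B1 B2 u) \<le> \<bar>- A * ?e - B2 * exp (2 * snd u)\<bar> + \<bar>- A * ?e + B1 * exp (2 * fst u)\<bar>"
    unfolding source_def by (rule order_trans[OF norm_Pair_le]) simp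
  also have "\<dots> \<le> (\<bar>A * ?e\<bar> + \<bar>B2 * exp (2 * snd u)\<bar>) + (\<bar>A * ?e\<bar> + \<bar>B1 * exp (2 * fst u)\<bar>)"
    by (intro add_mono) auto
  also have "\<dots> \<le> (A * exp (4 * c) + B2 * exp (4 * c)) + (A * exp (4 * c) + B1 * exp (4 * c))"
    unfolding abs_mult abs_of_nonneg[OF A(1)] abs_of_nonneg[OF A(2)] abs_of_nonneg[OF A(3)] abs_exp_cancel
    by (intro add_mono mult_left_mono 1 2 u A)
  finally show ?thesis by (simp add: algebra_simps)
qed

text \<open>The Liouville part cancels at zero because of the \<open>- 1\<close> in
  \<open>source\<close>. What is left are the terms that later carry the factor
  \<open>\<epsilon>\<close>, the only origin of smallness.\<close>

lemma norm_source_0_le: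
  assumes "B1 \<ge> 0" "B2 \<ge> 0"
  shows "norm (source A B1 B2 0) \<le> B1 + B2"
  unfolding source_def by (rule order_trans[OF norm_Pair_le]) (use assms in simp)

lemma continuous_on_source:
  assumes "continuous_on S A" "continuous_on S B1" "continuous_on S B2" "continuous_on S u"
  shows "continuous_on S (\<lambda>t. source (A t) (B1 t) (B2 t) (u t))"
  unfolding source_def by (intro continuous_intros assms)

lemma min_one_le_powr:
  fixes z \<theta> :: real
  assumes "z \<ge> 0" "0 < \<theta>" "\<theta> \<le> 1"
  shows "min 1 z \<le> z powr \<theta>"
proof (cases "z \<le> 1")
  case True
  show ?thesis
  proof (cases "z = 0")
    case False
    then have "z powr 1 \<le> z powr \<theta>" using assms True by (intro powr_mono') auto
    then show ?thesis using assms True by simp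
  qed simp
next
  case False
  then have "1 \<le> z powr \<theta>" using assms by (intro ge_one_powr_ge_zero) auto
  then show ?thesis by simp
qed

section \<open>Integrals and averages of functions with decay exponent 5/4\<close>

lemma norm_integral_decay_le:
  fixes f :: "real \<Rightarrow> 'a::banach"
  assumes f: "continuous_on {0..} f"
    and le: "\<And>s. s \<ge> 0 \<Longrightarrow> norm (f s) \<le> d * (1 + s) powr (-5/4)"
    and "t \<ge> 0"
  shows "norm (integral {0..t} f) \<le> 4 * d"
proof -
  have d: "d \<ge> 0" using le[of 0] order_trans[OF norm_ge_zero] by force
  have ftc: "((\<lambda>s. d * (1 + s) powr (-5/4)) has_integral
     (- 4 * d * (1 + t) powr (-1/4) - (- 4 * d * (1 + 0) powr (-1/4)))) {0..t}"
  proof (rule fundamental_theorem_of_calculus[OF \<open>t \<ge> 0\<close>])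
    fix s assume "s \<in> {0..t}"
    then have "((\<lambda>s. - 4 * d * (1 + s) powr (-1/4)) has_real_derivative
            d * (1 + s) powr (-5/4)) (at s within {0..t})"
      by (auto intro!: derivative_eq_intros)
    then show "((\<lambda>s. - 4 * d * (1 + s) powr (-1/4)) has_vector_derivative d * (1 + s) powr (-5/4))
                 (at s within {0..t})"
      by (simp add: has_real_derivative_iff_has_vector_derivative)
  qed
  have "norm (integral {0..t} f) \<le> integral {0..t} (\<lambda>s. d * (1 + s) powr (-5/4))"
    by (intro Henstock_Kurzweil_Integration.integral_norm_bound_integral le
              integrable_continuous_real continuous_on_subset[OF f] has_integral_integrable[OF ftc]) auto
  also have "\<dots> = 4 * d - 4 * d * (1 + t) powr (-1/4)"
    using integral_unique[OF ftc] by simp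
  also have "\<dots> \<le> 4 * d" using d by simp
  finally show ?thesis .
qed

lemma scaleR_average:
  fixes f :: "real \<Rightarrow> 'a::banach"
  assumes f: "continuous_on {0..} f" and "t \<ge> 0"
  shows "t *\<^sub>R integral {0..1} (\<lambda>\<theta>. f (t * \<theta>)) = integral {0..t} f"
proof (cases "t = 0")
  case False
  then have "t > 0" using assms by simp
  have "f integrable_on {0..t}"
    by (intro integrable_continuous_real continuous_on_subset[OF f]) auto
  then have "(f has_integral integral {0..t} f) (cbox 0 t)" by (simp add: integrable_integral)
  from has_integral_affinity[OF this, of t 0] \<open>t > 0\<close>
  have "((\<lambda>\<theta>. f (t * \<theta>)) has_integral (1 / t) *\<^sub>R integral {0..t} f) ((\<lambda>x. x / t) ` {0..t})"
    by (simp add: divide_inverse mult.commute)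
  also have "(\<lambda>x. x / t) ` {0..t} = {0..1}"
    using \<open>t > 0\<close> by (simp add: image_divide_atLeastAtMost)
  finally show ?thesis using \<open>t > 0\<close> by (simp add: integral_unique)
qed simp

text \<open>Two bounds are merged: the average is at most \<open>d\<close>, and \<open>t\<close>
  times the average is the integral over \<open>{0..t}\<close>, at most \<open>4 * d\<close>. Their
  sum bounds \<open>1 + t\<close> times the average.\<close>

lemma norm_average_decay_le:
  fixes f :: "real \<Rightarrow> 'a::banach"
  assumes f: "continuous_on {0..} f"
    and le: "\<And>s. s \<ge> 0 \<Longrightarrow> norm (f s) \<le> d * (1 + s) powr (-5/4)"
    and "t \<ge> 0"
  shows "norm (integral {0..1} (\<lambda>\<theta>. f (t * \<theta>))) \<le> 5 * d / (1 + t)" (is "norm ?J \<le> _")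
proof -
  have d: "d \<ge> 0" using le[of 0] order_trans[OF norm_ge_zero] by force
  have "norm ?J \<le> integral {0..1::real} (\<lambda>_. d)"
  proof (rule Henstock_Kurzweil_Integration.integral_norm_bound_integral)
    show "(\<lambda>\<theta>. f (t * \<theta>)) integrable_on {0..1}"
      by (intro integrable_continuous_real continuous_on_compose2[OF f] continuous_intros)
         (use \<open>t \<ge> 0\<close> in auto)
    fix \<theta> :: real assume "\<theta> \<in> {0..1}"
    then have "norm (f (t * \<theta>)) \<le> d * (1 + t * \<theta>) powr (-5/4)"
      using \<open>t \<ge> 0\<close> by (intro le) auto
    also have "\<dots> \<le> d * 1"
      using d \<open>t \<ge> 0\<close> \<open>\<theta> \<in> {0..1}\<close> powr_mono2'[of "-5/4" 1 "1 + t * \<theta>"] by (intro mult_left_mono) auto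
    finally show "norm (f (t * \<theta>)) \<le> d" by simp
  qed auto
  then have "norm ?J \<le> d" by simp
  moreover have "t * norm ?J \<le> 4 * d"
    using norm_integral_decay_le[OF f le \<open>t \<ge> 0\<close>] scaleR_average[OF f \<open>t \<ge> 0\<close>] \<open>t \<ge> 0\<close>
    by (metis abs_of_nonneg norm_scaleR)
  ultimately have "(1 + t) * norm ?J \<le> 5 * d" by (simp add: algebra_simps)
  then show ?thesis using \<open>t \<ge> 0\<close> by (simp add: field_simps)
qed

lemma perturbed_solution:
  fixes A B1 B2 :: "real \<Rightarrow> real"
  assumes cont: "continuous_on {0..} A" "continuous_on {0..} B1" "continuous_on {0..} B2"
    and nonneg: "\<And>t. t \<ge> 0 \<Longrightarrow> A t \<ge> 0" "\<And>t. t \<ge> 0 \<Longrightarrow> B1 t \<ge> 0" "\<And>t. t \<ge> 0 \<Longrightarrow> B2 t \<ge> 0"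
    and bound: "\<And>t. t \<ge> 0 \<Longrightarrow> A t \<le> b / (1 + t)\<^sup>2" "\<And>t. t \<ge> 0 \<Longrightarrow> B1 t \<le> b / (1 + t)\<^sup>2"
      "\<And>t. t \<ge> 0 \<Longrightarrow> B2 t \<le> b / (1 + t)\<^sup>2"
  shows "\<exists>\<eta> \<epsilon>0. \<epsilon>0 > 0 \<and> (\<eta> \<longlongrightarrow> 0) (at_right 0) \<and> (\<forall>\<epsilon>\<in>{0<..<\<epsilon>0}. 0 \<le> \<eta> \<epsilon> \<and> \<eta> \<epsilon> \<le> 1/40 \<and>
    (\<exists>f g. continuous_on {0..} g \<and> (\<forall>t\<ge>0. f t = source (A t) (\<epsilon> * B1 t) (\<epsilon> * B2 t) (g t) \<and>
       g t = integral {0..t} (\<lambda>s. integral {0..1} (\<lambda>\<theta>. f (s * \<theta>))) \<and>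
       norm (f t) \<le> \<eta> \<epsilon> * (1 + t) powr (-5/4) \<and>
       norm (integral {0..1} (\<lambda>\<theta>. f (t * \<theta>))) \<le> \<eta> \<epsilon> / (1 + t) \<and>
       norm (g t) \<le> \<eta> \<epsilon> * ln (1 + t))))"
proof -
  have b: "b \<ge> 0" using bound(1)[of 0] nonneg(1)[of 0] by simp
  \<comment> \<open>The sum \<open>8 + 2 + 2\<close> from the Lipschitz bound of
    \<open>source\<close>, all three coefficients being at most \<open>b / (1 + t)^2\<close> when
    \<open>\<epsilon> \<le> 1\<close>. It also covers the plain bound of the source, whose
    coefficients sum to 4.\<close>
  define \<Lambda> where "\<Lambda> = 12 * b"
  have L0: "\<Lambda> \<ge> 0" using b by (simp add: \<Lambda>_def)
  define m where "m = nat \<lceil>2 * \<Lambda>\<rceil>"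
  have m: "2 * \<Lambda> \<le> real (Suc m)" unfolding m_def by linarith
  \<comment> \<open>Chosen so that the growth \<open>(1 + t) ^ Suc m\<close>, raised to the power
    \<open>\<theta>\<close>, costs exactly \<open>1/4\<close>: the exponent
    \<open>-3/2 + 1/4 = -5/4\<close> is still integrable.\<close>
  define \<theta> where "\<theta> = 1 / (4 * real (Suc m))"
  have \<theta>: "0 < \<theta>" "\<theta> \<le> 1" by (auto simp: \<theta>_def)
  define D where "D = \<Lambda> * (4 * b) + 2 * b + \<Lambda>"
  have D: "D \<ge> 0" "\<Lambda> \<le> D" using b L0 by (auto simp: D_def)
  define \<eta> where "\<eta> \<epsilon> = 5 * (D * \<epsilon> powr \<theta>)" for \<epsilon>
  have \<eta>0: "\<eta> \<epsilon> \<ge> 0" for \<epsilon> using D by (simp add: \<eta>_def)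
  have "((\<lambda>\<epsilon>. \<epsilon> powr \<theta>) \<longlongrightarrow> 0) (at_right 0)"
    using \<theta> tendsto_powr2[OF tendsto_ident_at tendsto_const, of 0 "{0<..}" \<theta>]
    by (auto simp: eventually_at_filter)
  from tendsto_mult_left[OF tendsto_mult_left[OF this, of D], of 5]
  have lim: "(\<eta> \<longlongrightarrow> 0) (at_right 0)"
    by (simp add: \<eta>_def[abs_def])
  then have "\<forall>\<^sub>F \<epsilon> in at_right 0. \<eta> \<epsilon> < 1/40" by (rule order_tendstoD) simp
  then obtain \<epsilon>1 where \<epsilon>1: "\<epsilon>1 > 0" "\<And>\<epsilon>. 0 < \<epsilon> \<Longrightarrow> \<epsilon> < \<epsilon>1 \<Longrightarrow> \<eta> \<epsilon> < 1/40"
    by (auto simp: eventually_at_right_field)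
  \<comment> \<open>The slope \<open>1/8\<close> makes \<open>exp (4 * c t)\<close> equal to
    \<open>(1 + t) powr (1/2)\<close>, so coefficients with quadratic decay keep the decay
    \<open>(1 + t) powr (-3/2)\<close> after multiplication.\<close>
  define c :: "real \<Rightarrow> real" where "c t = ln (1 + t) / 8" for t
  have c0: "c t \<ge> 0" if "t \<ge> 0" for t using that by (simp add: c_def)
  have e4: "exp (4 * c t) * (x / (1 + t)\<^sup>2) = x * (1 + t) powr (-3/2)" if "t \<ge> 0" for t x
  proof -
    have "exp (4 * c t) = (1 + t) powr (1/2)" using that by (simp add: c_def powr_def)
    moreover have "(1 + t) powr (1/2) = (1 + t) powr (-3/2) * (1 + t) powr 2"
      by (simp flip: powr_add)
    moreover have "(1 + t) powr 2 = (1 + t)\<^sup>2" using that by simp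
    ultimately show ?thesis using that by simp
  qed
  have clipc: "fst (clip (c t) u) \<le> c t" "snd (clip (c t) u) \<le> c t" for t u
    by (auto simp: clip_def)
  have sol: "\<exists>f g. continuous_on {0..} g \<and> (\<forall>t\<ge>0. f t = source (A t) (\<epsilon> * B1 t) (\<epsilon> * B2 t) (g t) \<and>
       g t = integral {0..t} (\<lambda>s. integral {0..1} (\<lambda>\<theta>. f (s * \<theta>))) \<and>
       norm (f t) \<le> \<eta> \<epsilon> * (1 + t) powr (-5/4) \<and>
       norm (integral {0..1} (\<lambda>\<theta>. f (t * \<theta>))) \<le> \<eta> \<epsilon> / (1 + t) \<and>
       norm (g t) \<le> \<eta> \<epsilon> * ln (1 + t))"
    if \<epsilon>: "0 < \<epsilon>" "\<epsilon> \<le> 1" "\<eta> \<epsilon> \<le> 1/40" for \<epsilon>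
  proof -
    define G where "G t u = source (A t) (\<epsilon> * B1 t) (\<epsilon> * B2 t) (clip (c t) u)" for t u
    have B\<epsilon>: "0 \<le> \<epsilon> * B1 t" "0 \<le> \<epsilon> * B2 t" "\<epsilon> * B1 t \<le> \<epsilon> * (b / (1 + t)\<^sup>2)"
        "\<epsilon> * B2 t \<le> \<epsilon> * (b / (1 + t)\<^sup>2)" "\<epsilon> * (b / (1 + t)\<^sup>2) \<le> b / (1 + t)\<^sup>2" if "t \<ge> 0" for t
      using nonneg(2,3)[OF that] mult_left_mono[OF bound(2)[OF that], of \<epsilon>]
        mult_left_mono[OF bound(3)[OF that], of \<epsilon>]
        mult_left_le_one_le[of "b / (1 + t)\<^sup>2" \<epsilon>] \<epsilon> b by auto
    have X: "(1 + t) powr (-3/2) \<le> 1 / (1 + t)" if "t \<ge> 0" for t :: real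
      using powr_mono[of "-3/2" "-1" "1 + t"] that by (simp add: powr_minus_divide)
    have X1: "(1 + t) powr (-3/2) \<le> 1" if "t \<ge> 0" for t :: real
      using powr_mono[of "-3/2" "0" "1 + t"] that by simp
    have lip: "norm (G t u - G t v) \<le> \<Lambda> * (1 + t) powr (-3/2) * norm (u - v)" if t: "t \<ge> 0" for t u v
    proof -
      have "norm (G t u - G t v) \<le>
         exp (4 * c t) * (8 * A t + 2 * (\<epsilon> * B1 t) + 2 * (\<epsilon> * B2 t)) * norm (clip (c t) u - clip (c t) v)"
        unfolding G_def by (intro norm_source_diff_le clipc c0 nonneg B\<epsilon> t)
      also have "\<dots> \<le> exp (4 * c t) * (12 * b / (1 + t)\<^sup>2) * norm (u - v)"
        using b bound(1)[OF t] B\<epsilon>[OF t] nonneg(1)[OF t]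
        by (intro mult_mono norm_clip_diff_le) auto
      also have "\<dots> = \<Lambda> * (1 + t) powr (-3/2) * norm (u - v)"
        unfolding e4[OF t] \<Lambda>_def ..
      finally show ?thesis .
    qed
    have Gle: "norm (G t u) \<le> \<Lambda> * (1 + t) powr (-3/2)" if t: "t \<ge> 0" for t u
    proof -
      have "norm (G t u) \<le> exp (4 * c t) * (2 * A t + \<epsilon> * B1 t + \<epsilon> * B2 t)"
        unfolding G_def by (intro norm_source_le clipc c0 nonneg B\<epsilon> t)
      also have "\<dots> \<le> exp (4 * c t) * (12 * b / (1 + t)\<^sup>2)"
        using bound(1)[OF t] B\<epsilon>[OF t] nonneg(1)[OF t] by (intro mult_left_mono) auto
      also have "\<dots> = \<Lambda> * (1 + t) powr (-3/2)"
        unfolding e4[OF t] \<Lambda>_def ..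
      finally show ?thesis .
    qed
    have G0: "norm (G t 0) \<le> 2 * b * \<epsilon> * (1 + t) powr (-3/2)" if t: "t \<ge> 0" for t
    proof -
      have "clip (c t) 0 = 0" using c0[OF t] by (simp add: clip_def zero_prod_def)
      then have "norm (G t 0) \<le> \<epsilon> * B1 t + \<epsilon> * B2 t"
        using norm_source_0_le[OF B\<epsilon>(1,2)[OF t]] by (simp add: G_def)
      also have "\<dots> \<le> \<epsilon> * (b / (1 + t)\<^sup>2) + \<epsilon> * (b / (1 + t)\<^sup>2)"
        using B\<epsilon>(3,4)[OF t] by (rule add_mono)
      also have "\<dots> = 1 * (2 * b * \<epsilon> / (1 + t)\<^sup>2)" by simp
      also have "\<dots> \<le> exp (4 * c t) * (2 * b * \<epsilon> / (1 + t)\<^sup>2)"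
        using c0[OF t] b \<epsilon> by (intro mult_right_mono) auto
      also have "\<dots> = 2 * b * \<epsilon> * (1 + t) powr (-3/2)" unfolding e4[OF t] ..
      finally show ?thesis .
    qed
    have contG: "continuous_on ({0..} \<times> UNIV) (\<lambda>(t, u). G t u)"
      unfolding G_def case_prod_beta clip_def c_def
      by (intro continuous_on_source continuous_intros continuous_on_compose2[OF cont(1)]
            continuous_on_compose2[OF cont(2)] continuous_on_compose2[OF cont(3)]) auto
    obtain g where g: "continuous_on {0..} g"
      "\<And>t. t \<ge> 0 \<Longrightarrow> g t = integral {0..t} (\<lambda>s. integral {0..1} (\<lambda>\<theta>. G (s * \<theta>) (g (s * \<theta>))))"
      "\<And>t. t \<ge> 0 \<Longrightarrow> norm (g t) \<le> 2 * (2 * b * \<epsilon>) * (1 + t) ^ Suc m"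
    proof -
      have "norm (G t u - G t v) \<le> \<Lambda> / (1 + t) * norm (u - v)" if "t \<ge> 0" for t u v
        using lip[OF that, of u v] mult_right_mono[OF mult_left_mono[OF X[OF that] L0], of "norm (u - v)"]
        by simp
      moreover have "norm (G t 0) \<le> 2 * b * \<epsilon>" if "t \<ge> 0" for t
        using G0[OF that] mult_left_mono[OF X1[OF that], of "2 * b * \<epsilon>"] b \<epsilon> by simp
      ultimately show ?thesis
        using volterra_fixpoint[OF contG _ _ L0 m, of "2 * b * \<epsilon>"] that by blast
    qed
    define f where "f t = G t (g t)" for t
    have contf: "continuous_on {0..} f"
      using continuous_on_compose2[OF contG, of "{0..}" "\<lambda>t. (t, g t)"]
      unfolding f_def by (force intro!: continuous_intros g(1))
    define d where "d = D * \<epsilon> powr \<theta>"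
    have d5: "\<eta> \<epsilon> = 5 * d" by (simp add: \<eta>_def d_def)
    have d0: "d \<ge> 0" using D by (simp add: d_def)
    have fle: "norm (f t) \<le> d * (1 + t) powr (-5/4)" if t: "t \<ge> 0" for t
    proof -
      define Y where "Y = (1 + t) powr (-3/2)"
      define Z where "Z = \<epsilon> * (1 + t) ^ Suc m"
      have Y: "Y \<ge> 0" by (simp add: Y_def)
      have Z: "Z \<ge> \<epsilon>" "Z \<ge> 0" using t \<epsilon> by (auto simp: Z_def simp del: power_Suc)
      have 1: "norm (f t) \<le> D * Y * 1"
        using Gle[OF t, of "g t"] mult_right_mono[OF D(2) Y] by (simp add: f_def Y_def)
      \<comment> \<open>Second bound, by comparison with the zero function: both terms carry the
        factor \<open>\<epsilon>\<close>, but the first grows like the weight of the fixed point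
        space.\<close>
      have "norm (f t) \<le> norm (G t (g t) - G t 0) + norm (G t 0)"
        unfolding f_def by (metis add.commute norm_triangle_sub)
      also have "\<dots> \<le> \<Lambda> * Y * (2 * (2 * b * \<epsilon>) * (1 + t) ^ Suc m) + 2 * b * \<epsilon> * Y"
        unfolding Y_def using L0 g(3)[OF t]
        by (intro add_mono G0[OF t] order_trans[OF lip[OF t]] mult_left_mono) auto
      also have "\<dots> = \<Lambda> * (4 * b) * (Y * Z) + 2 * b * (\<epsilon> * Y)" by (simp add: Z_def)
      also have "\<epsilon> * Y \<le> Y * Z" using mult_right_mono[OF Z(1) Y] by (simp add: mult.commute)
      also have "\<Lambda> * (4 * b) * (Y * Z) + 2 * b * (Y * Z) \<le> D * Y * Z"
        using L0 Y Z by (simp add: D_def algebra_simps)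
      finally have "norm (f t) \<le> D * Y * Z" using b by (simp add: mult_left_mono)
      \<comment> \<open>Interpolation: the uniform decay and the polynomially growing bound of order \<open>\<epsilon>\<close> combine to
        a bound that decays and is small with \<open>\<epsilon>\<close>.\<close>
      with 1 have "norm (f t) \<le> D * Y * min 1 Z" by (simp add: min_def)
      also have "\<dots> \<le> D * Y * Z powr \<theta>"
        using D Y Z \<theta> by (intro mult_left_mono min_one_le_powr) auto
      also have "Z powr \<theta> = \<epsilon> powr \<theta> * (1 + t) powr (1/4)"
      proof -
        have "real (Suc m) * \<theta> = 1/4" by (simp add: \<theta>_def)
        moreover have "(1 + t) ^ Suc m = (1 + t) powr real (Suc m)"
          by (rule powr_realpow[symmetric]) (use t in simp)
        ultimately show ?thesis
          using t \<epsilon> by (simp only: Z_def powr_mult powr_powr)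
      qed
      also have "D * Y * (\<epsilon> powr \<theta> * (1 + t) powr (1/4)) = d * ((1 + t) powr (-3/2) * (1 + t) powr (1/4))"
        by (simp add: Y_def d_def)
      also have "\<dots> = d * (1 + t) powr (-5/4)" by (simp flip: powr_add)
      finally show ?thesis .
    qed
    let ?J = "\<lambda>t. integral {0..1} (\<lambda>\<theta>. f (t * \<theta>))"
    have Jle: "norm (?J t) \<le> 5 * d / (1 + t)" if "t \<ge> 0" for t
      by (rule norm_average_decay_le[OF contf fle that])
    have gle: "norm (g t) \<le> 5 * d * ln (1 + t)" if t: "t \<ge> 0" for t
    proof -
      have ftc: "((\<lambda>s. 5 * d / (1 + s)) has_integral (5 * d * ln (1 + t) - 5 * d * ln (1 + 0))) {0..t}"
      proof (rule fundamental_theorem_of_calculus[OF t])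
        fix s assume "s \<in> {0..t}"
        then have "((\<lambda>s. 5 * d * ln (1 + s)) has_real_derivative 5 * d / (1 + s)) (at s within {0..t})"
          by (auto intro!: derivative_eq_intros)
        then show "((\<lambda>s. 5 * d * ln (1 + s)) has_vector_derivative 5 * d / (1 + s)) (at s within {0..t})"
          by (simp add: has_real_derivative_iff_has_vector_derivative)
      qed
      have "norm (g t) = norm (integral {0..t} ?J)" using g(2)[OF t] by (simp add: f_def)
      also have "\<dots> \<le> integral {0..t} (\<lambda>s. 5 * d / (1 + s))"
        by (intro Henstock_Kurzweil_Integration.integral_norm_bound_integral Jle integrable_continuous_real
              continuous_on_subset[OF continuous_on_average[OF contf]] has_integral_integrable[OF ftc]) auto
      also have "\<dots> = 5 * d * ln (1 + t)" using integral_unique[OF ftc] by simp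
      finally show ?thesis .
    qed
    \<comment> \<open>The clipping is removed here: \<open>\<eta> \<epsilon> \<le> 1/40\<close>
      keeps \<open>norm (g t)\<close> below \<open>ln (1 + t) / 8\<close>, which is the level
      \<open>c t\<close>.\<close>
    have "f t = source (A t) (\<epsilon> * B1 t) (\<epsilon> * B2 t) (g t)" if t: "t \<ge> 0" for t
    proof -
      have "norm (g t) \<le> 1/8 * ln (1 + t)"
        using order_trans[OF gle[OF t] mult_right_mono[of "5 * d" "1/8"]] \<epsilon>(3) d5 t by simp
      then have "fst (g t) \<le> c t" "snd (g t) \<le> c t"
        using abs_fst_le[of "g t"] abs_snd_le[of "g t"] by (auto simp: c_def)
      then have "clip (c t) (g t) = g t" by (simp add: clip_def)
      then show ?thesis by (simp add: f_def G_def)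
    qed
    moreover have "norm (f t) \<le> \<eta> \<epsilon> * (1 + t) powr (-5/4)" if t: "t \<ge> 0" for t
      by (rule order_trans[OF fle[OF t] mult_right_mono]) (use d0 d5 in auto)
    ultimately show ?thesis
      using g(1,2) Jle gle unfolding d5 by (intro exI[of _ f] exI[of _ g]) (auto simp: f_def)
  qed
  show ?thesis
    by (rule exI[of _ \<eta>], rule exI[of _ "min \<epsilon>1 1"], intro conjI ballI sol)
       (use lim \<epsilon>1 \<eta>0 in \<open>auto intro: less_imp_le\<close>)
qed

text \<open>
  Solving \<open>(t J)' = f\<close> loses a power of \<open>t\<close> at the origin; that \<open>f\<close> vanishes there makes \<open>J\<close> of
  class \<open>C\<^sup>1\<close> up to \<open>t = 0\<close>.
\<close>

lemma average_has_derivative: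
  fixes f k :: "real \<Rightarrow> 'a::banach"
  assumes k: "continuous_on {0..} k" and f: "\<And>t. t \<ge> 0 \<Longrightarrow> f t = t *\<^sub>R k t"
  defines "J \<equiv> (\<lambda>t. integral {0..1} (\<lambda>\<theta>. f (t * \<theta>)))"
  shows "\<exists>Q. continuous_on {0..} Q \<and>
     (\<forall>t\<ge>0. (J has_vector_derivative Q t) (at t within {0..}) \<and> J t + t *\<^sub>R Q t = f t)"
proof -
  have contf: "continuous_on {0..} f"
    by (subst continuous_on_cong[OF refl f]) (auto intro!: continuous_intros k)
  define k2 where "k2 t = integral {0..1} (\<lambda>\<theta>. \<theta> *\<^sub>R k (t * \<theta>))" for t
  have k2: "continuous_on {0..} k2"
  proof -
    have "continuous_on ({0..} \<times> cbox 0 (1::real)) (\<lambda>(s, \<theta>). \<theta> *\<^sub>R k (s * \<theta>))"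
      unfolding case_prod_beta
      by (intro continuous_on_compose2[OF k] continuous_intros) auto
    from integral_continuous_on_param[OF this] show ?thesis by (simp add: k2_def[abs_def])
  qed
  have J: "J t = t *\<^sub>R k2 t" if "t \<ge> 0" for t
  proof -
    have "J t = integral {0..1} (\<lambda>\<theta>. t *\<^sub>R (\<theta> *\<^sub>R k (t * \<theta>)))"
      unfolding J_def by (intro Henstock_Kurzweil_Integration.integral_cong) (use that in \<open>auto simp: f\<close>)
    then show ?thesis unfolding k2_def integral_cmul .
  qed
  have k20: "k2 0 = (1/2) *\<^sub>R k 0"
  proof -
    have "((\<lambda>\<theta>::real. \<theta>) has_integral (1\<^sup>2 - 0\<^sup>2) / 2) {0..1}"
      by (rule ident_has_integral) simp
    from has_integral_scaleR_left[OF this, of "k 0"] show ?thesis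
      by (simp add: k2_def integral_unique)
  qed
  \<comment> \<open>For \<open>t > 0\<close> this is forced by
    \<open>t J' = f - J = t (k - k2)\<close>. At \<open>t = 0\<close> the difference quotient yields
    \<open>k2 0\<close> instead; the two agree because each is half of \<open>k 0\<close>.\<close>
  define Q where "Q t = k t - k2 t" for t
  have der: "(J has_vector_derivative Q t) (at t within {0..})" if t: "t \<ge> 0" for t
  proof (cases "t = 0")
    case True
    have lim: "(k2 \<longlongrightarrow> k2 0) (at 0 within {0..})"
      using k2 by (auto simp: continuous_on_def)
    have "((\<lambda>y. k2 y - k2 0) \<longlongrightarrow> 0) (at 0 within {0..})"
      using tendsto_diff[OF lim tendsto_const[of "k2 0"]] by simp
    then have "((\<lambda>y. (1 / norm (y - 0)) *\<^sub>R (J y - (J 0 + (y - 0) *\<^sub>R k2 0))) \<longlongrightarrow> 0) (at 0 within {0..})"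
      by (rule Lim_transform_eventually)
         (auto simp: eventually_at_filter J intro!: always_eventually simp flip: scaleR_diff_right)
    then have "(J has_vector_derivative k2 0) (at 0 within {0..})"
      unfolding has_vector_derivative_def has_derivative_within
      by (simp add: bounded_linear_scaleR_left)
    then show ?thesis using True k20 scaleR_left_diff_distrib[of 1 "1/2" "k 0"] by (simp add: Q_def)
  next
    case False
    then have "t > 0" using t by simp
    have 1: "((\<lambda>s. (1 / s) *\<^sub>R integral {0..s} f) has_vector_derivative
       (1 / t) *\<^sub>R f t + (- 1 / t\<^sup>2) *\<^sub>R integral {0..t} f) (at t within {0..})"
      using \<open>t > 0\<close>
      by (intro has_vector_derivative_scaleR has_vector_derivative_integral_from_0[OF contf t])
         (auto intro!: derivative_eq_intros simp: power2_eq_square)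
    have 2: "J s = (1 / s) *\<^sub>R integral {0..s} f" if "s > 0" for s
    proof -
      have "(1 / s) *\<^sub>R (s *\<^sub>R J s) = J s" using that by simp
      then show ?thesis using scaleR_average[OF contf, of s] that by (simp add: J_def)
    qed
    have "(J has_vector_derivative (1 / t) *\<^sub>R f t + (- 1 / t\<^sup>2) *\<^sub>R integral {0..t} f) (at t within {0..})"
      by (rule has_vector_derivative_transform_within[OF 1 \<open>t > 0\<close>])
         (use t 2 in \<open>auto simp: dist_real_def\<close>)
    moreover have "integral {0..t} f = t *\<^sub>R (t *\<^sub>R k2 t)"
      using scaleR_average[OF contf t] J[OF t] by (simp add: J_def)
    ultimately show ?thesis using \<open>t > 0\<close> f[OF t] by (simp add: Q_def power2_eq_square)
  qed
  have "continuous_on {0..} Q" unfolding Q_def by (intro continuous_intros k k2)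
  moreover have "J t + t *\<^sub>R Q t = f t" if "t \<ge> 0" for t
    using that by (simp add: J f Q_def algebra_simps)
  ultimately show ?thesis using der by blast
qed

text \<open>Quadratic decay is what the perturbation argument asks of its coefficients. It is
  available since \<open>M - N1 = N2 + 1\<close> and \<open>M - N2 = N1 + 1\<close> are at least 2
  for zeros of positive order. The constant 4 is the square of the 2 in
  \<open>1 + t \<le> 2 * max 1 t\<close>.\<close>

lemma rational_weight_le:
  fixes t :: real
  assumes "t \<ge> 0" "n + 2 \<le> M"
  shows "t ^ n / (1 + t ^ M) \<le> 4 / (1 + t)\<^sup>2"
proof -
  have "t ^ n * (1 + t)\<^sup>2 \<le> 4 * (1 + t ^ M)"
  proof (cases "t \<le> 1")
    case True
    have "t ^ n * (1 + t)\<^sup>2 \<le> 1 * 2\<^sup>2"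
      using assms True by (intro mult_mono power_mono power_le_one) auto
    also have "\<dots> \<le> 4 * (1 + t ^ M)" using assms by simp
    finally show ?thesis .
  next
    case False
    have "t ^ n * (1 + t)\<^sup>2 \<le> t ^ n * (2 * t)\<^sup>2"
      using assms False by (intro mult_left_mono power_mono) auto
    also have "\<dots> = 4 * t ^ (n + 2)" by (simp add: power_add power2_eq_square)
    also have "\<dots> \<le> 4 * t ^ M" using assms False by (intro mult_left_mono power_increasing) auto
    finally show ?thesis using assms by simp
  qed
  moreover have "1 + t ^ M > 0" using assms by (simp add: add_pos_nonneg)
  ultimately show ?thesis using assms by (simp add: field_simps)
qed

text \<open>Up to a constant and rescaling, the squared modulus of a field with a zero of order
  \<open>n\<close> before correction: \<open>t ^ n\<close> from the zero, and
  \<open>1 / (1 + t ^ M)\<close> from the square of the exponential of the Liouville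
  profile.\<close>

definition rational_weight :: "nat \<Rightarrow> nat \<Rightarrow> real \<Rightarrow> real" where
  "rational_weight M n t = t ^ n / (1 + t ^ M)"

lemma one_plus_power_pos: "t \<ge> 0 \<Longrightarrow> 1 + t ^ M > (0::real)"
  by (simp add: add_pos_nonneg)

lemma continuous_on_rational_weight: "continuous_on {0..} (rational_weight M n)"
  unfolding rational_weight_def by (intro continuous_intros) (metis atLeast_iff less_irrefl one_plus_power_pos)

lemma rational_weight_nonneg: "t \<ge> 0 \<Longrightarrow> rational_weight M n t \<ge> 0"
  by (simp add: rational_weight_def)

lemma rational_weight_Suc: "rational_weight M (Suc n) t = t * rational_weight M n t"
  by (simp add: rational_weight_def)

lemma radial_solution:
  fixes N1 N2 :: nat
  assumes N: "N1 \<ge> 1" "N2 \<ge> 1"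
  defines "M \<equiv> Suc (N1 + N2)"
  shows "\<exists>\<eta> \<epsilon>0. \<epsilon>0 > 0 \<and> (\<eta> \<longlongrightarrow> 0) (at_right 0) \<and> (\<forall>\<epsilon>\<in>{0<..<\<epsilon>0}. 0 \<le> \<eta> \<epsilon> \<and> \<eta> \<epsilon> \<le> 1/40 \<and>
    (\<exists>f g P Q. continuous_on {0..} f \<and> continuous_on {0..} Q \<and> (\<forall>t\<ge>0.
       f t = source (real M ^ 2 / 2 * (rational_weight M N1 t * rational_weight M N2 t)) (\<epsilon> * rational_weight M N1 t) (\<epsilon> * rational_weight M N2 t) (g t) \<and>
       (g has_vector_derivative P t) (at t within {0..}) \<and>
       (P has_vector_derivative Q t) (at t within {0..}) \<and>
       P t + t *\<^sub>R Q t = f t \<and>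
       norm (f t) \<le> \<eta> \<epsilon> * (1 + t) powr (-5/4) \<and>
       norm (P t) \<le> \<eta> \<epsilon> / (1 + t) \<and>
       norm (g t) \<le> \<eta> \<epsilon> * ln (1 + t))))"
proof -
  define A where "A t = real M ^ 2 / 2 * (rational_weight M N1 t * rational_weight M N2 t)" for t
  \<comment> \<open>For the product coefficient, \<open>M^2 / 2\<close> is multiplied by
    \<open>4 / (1 + t)^2\<close> for one weight and by the crude bound 4 for the other; the summand
    4 covers the single weights.\<close>
  define b where "b = 8 * real M ^ 2 + 4"
  have cont: "continuous_on {0..} A"
    unfolding A_def by (intro continuous_intros continuous_on_rational_weight)
  have wle: "rational_weight M n t \<le> 4 / (1 + t)\<^sup>2" if "t \<ge> 0" "n = N1 \<or> n = N2" for t n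
    unfolding rational_weight_def using that N by (intro rational_weight_le) (auto simp: M_def)
  have wb: "rational_weight M n t \<le> b / (1 + t)\<^sup>2" if "t \<ge> 0" "n = N1 \<or> n = N2" for t n
    using wle[OF that] by (rule order_trans) (use that in \<open>auto simp: b_def intro!: divide_right_mono\<close>)
  have A0: "A t \<ge> 0" if "t \<ge> 0" for t using that by (simp add: A_def rational_weight_nonneg)
  have Ab: "A t \<le> b / (1 + t)\<^sup>2" if "t \<ge> 0" for t
  proof -
    have "rational_weight M N2 t \<le> 4 / (1 + t)\<^sup>2" using that by (intro wle) auto
    also have "\<dots> \<le> 4 / 1" using that by (intro divide_left_mono) (auto simp: one_le_power)
    finally have "rational_weight M N2 t \<le> 4" by simp
    then have "rational_weight M N1 t * rational_weight M N2 t \<le> 4 / (1 + t)\<^sup>2 * 4"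
      using that by (intro mult_mono wle) (auto simp: rational_weight_nonneg)
    then have "A t \<le> real M ^ 2 / 2 * (4 / (1 + t)\<^sup>2 * 4)"
      unfolding A_def by (intro mult_left_mono) auto
    also have "\<dots> = 8 * real M ^ 2 / (1 + t)\<^sup>2" by simp
    also have "\<dots> \<le> b / (1 + t)\<^sup>2" by (intro divide_right_mono) (auto simp: b_def)
    finally show ?thesis .
  qed
  define R where "R d \<epsilon> f g t \<longleftrightarrow> f t = source (A t) (\<epsilon> * rational_weight M N1 t) (\<epsilon> * rational_weight M N2 t) (g t) \<and>
       g t = integral {0..t} (\<lambda>s. integral {0..1} (\<lambda>\<theta>. f (s * \<theta>))) \<and>
       norm (f t) \<le> d * (1 + t) powr (-5/4) \<and>
       norm (integral {0..1} (\<lambda>\<theta>. f (t * \<theta>))) \<le> d / (1 + t) \<and>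
       norm (g t) \<le> d * ln (1 + t)" for d \<epsilon> and f g :: "real \<Rightarrow> real \<times> real" and t
  have "\<exists>\<eta> \<epsilon>0. \<epsilon>0 > 0 \<and> (\<eta> \<longlongrightarrow> 0) (at_right 0) \<and> (\<forall>\<epsilon>\<in>{0<..<\<epsilon>0}. 0 \<le> \<eta> \<epsilon> \<and> \<eta> \<epsilon> \<le> 1/40 \<and>
    (\<exists>f g. continuous_on {0..} g \<and> (\<forall>t\<ge>0. R (\<eta> \<epsilon>) \<epsilon> f g t)))"
    unfolding R_def
    by (rule perturbed_solution[of A "rational_weight M N1" "rational_weight M N2" b])
       (use cont A0 Ab in \<open>auto intro: continuous_on_rational_weight rational_weight_nonneg wb\<close>)
  then obtain \<eta> \<epsilon>0 where \<epsilon>0: "\<epsilon>0 > 0" and \<eta>: "(\<eta> \<longlongrightarrow> 0) (at_right 0)"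
    and \<eta>b: "\<forall>\<epsilon>\<in>{0<..<\<epsilon>0}. 0 \<le> \<eta> \<epsilon> \<and> \<eta> \<epsilon> \<le> 1/40"
    and sol: "\<forall>\<epsilon>\<in>{0<..<\<epsilon>0}. \<exists>f g. continuous_on {0..} g \<and> (\<forall>t\<ge>0. R (\<eta> \<epsilon>) \<epsilon> f g t)"
    by blast
  have "\<exists>f g P Q. continuous_on {0..} f \<and> continuous_on {0..} Q \<and> (\<forall>t\<ge>0.
       f t = source (A t) (\<epsilon> * rational_weight M N1 t) (\<epsilon> * rational_weight M N2 t) (g t) \<and>
       (g has_vector_derivative P t) (at t within {0..}) \<and>
       (P has_vector_derivative Q t) (at t within {0..}) \<and>
       P t + t *\<^sub>R Q t = f t \<and>
       norm (f t) \<le> \<eta> \<epsilon> * (1 + t) powr (-5/4) \<and>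
       norm (P t) \<le> \<eta> \<epsilon> / (1 + t) \<and>
       norm (g t) \<le> \<eta> \<epsilon> * ln (1 + t))" if \<epsilon>: "\<epsilon> \<in> {0<..<\<epsilon>0}" for \<epsilon>
  proof -
    obtain f g where contg: "continuous_on {0..} g" and R: "\<And>t. t \<ge> 0 \<Longrightarrow> R (\<eta> \<epsilon>) \<epsilon> f g t"
      using sol \<epsilon> by blast
    note fg = R[unfolded R_def, THEN conjunct1] R[unfolded R_def, THEN conjunct2, THEN conjunct1]
    \<comment> \<open>Positive multiplicities let one factor \<open>t\<close> be taken out of every
      term of \<open>source\<close>. The quotient \<open>k\<close> is continuous at 0, which gives
      the second derivative of \<open>g\<close> up to the origin.\<close>
    obtain n1 n2 where n: "N1 = Suc n1" "N2 = Suc n2" using N by (metis Suc_le_D One_nat_def)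
    define k where "k t = source (real M ^ 2 / 2 * (rational_weight M n1 t * rational_weight M N2 t)) (\<epsilon> * rational_weight M n1 t) (\<epsilon> * rational_weight M n2 t) (g t)" for t
    have k: "continuous_on {0..} k"
      unfolding k_def by (intro continuous_on_source continuous_intros continuous_on_rational_weight contg)
    have fk: "f t = t *\<^sub>R k t" if "t \<ge> 0" for t
      using fg(1)[OF that] by (simp add: A_def k_def n rational_weight_Suc source_def algebra_simps)
    have contf: "continuous_on {0..} f"
      by (subst continuous_on_cong[OF refl fk]) (auto intro!: continuous_intros k)
    define P where "P t = integral {0..1} (\<lambda>\<theta>. f (t * \<theta>))" for t
    obtain Q where Q: "continuous_on {0..} Q"
      "\<And>t. t \<ge> 0 \<Longrightarrow> (P has_vector_derivative Q t) (at t within {0..})"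
      "\<And>t. t \<ge> 0 \<Longrightarrow> P t + t *\<^sub>R Q t = f t"
      using average_has_derivative[OF k fk] unfolding P_def[abs_def] by metis
    have "(g has_vector_derivative P t) (at t within {0..})" if "t \<ge> 0" for t
      by (rule has_vector_derivative_transform[OF _ _
            has_vector_derivative_integral_from_0[OF continuous_on_average[OF contf] that, folded P_def]])
         (use that fg(2) in \<open>auto simp: P_def\<close>)
    with Q(2,3) R have "f t = source (A t) (\<epsilon> * rational_weight M N1 t) (\<epsilon> * rational_weight M N2 t) (g t) \<and>
       (g has_vector_derivative P t) (at t within {0..}) \<and>
       (P has_vector_derivative Q t) (at t within {0..}) \<and>
       P t + t *\<^sub>R Q t = f t \<and>
       norm (f t) \<le> \<eta> \<epsilon> * (1 + t) powr (-5/4) \<and>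
       norm (P t) \<le> \<eta> \<epsilon> / (1 + t) \<and>
       norm (g t) \<le> \<eta> \<epsilon> * ln (1 + t)" if "t \<ge> 0" for t
      unfolding R_def P_def by (intro conjI) (use that in \<open>fast+\<close>)
    with Q(1) contf show ?thesis by blast
  qed
  note main = this
  show ?thesis
    by (rule exI[of _ \<eta>], rule exI[of _ \<epsilon>0], intro conjI ballI, rule \<epsilon>0, rule \<eta>,
        (drule bspec[OF \<eta>b], erule conjunct1), (drule bspec[OF \<eta>b], erule conjunct2),
        rule main[unfolded A_def])
qed

subsection \<open>Radial configurations\<close>

lemma partial_deriv_eq:
  assumes "(f has_derivative f') (at x)"
  shows "partial_deriv j f x = f' (axis j 1)"
  unfolding partial_deriv_def using frechet_derivative_at[OF assms] by simp

lemma C1_on_planeI: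
  assumes "\<And>x. (f has_derivative f' x) (at x)" "\<And>j. continuous_on UNIV (\<lambda>x. f' x (axis j 1))"
  shows "C1_on_plane f"
proof -
  have "partial_deriv j f = (\<lambda>x. f' x (axis j 1))" for j
    using partial_deriv_eq[OF assms(1)] by auto
  then show ?thesis
    using assms by (auto simp: C1_on_plane_def differentiable_def)
qed

lemma axis_2_nth [simp]:
  "axis (1::2) (1::real) $ 1 = 1" "axis (1::2) (1::real) $ 2 = 0"
  "axis (2::2) (1::real) $ 1 = 0" "axis (2::2) (1::real) $ 2 = 1"
  by (auto simp: axis_def)

text \<open>The conjugate coordinate is used because the operator \<open>d_1 - \<i> d_2\<close>,
  with \<open>d_j\<close> the partial derivatives, annihilates it and its powers.\<close>

definition conj_coord :: "real^2 \<Rightarrow> real^2 \<Rightarrow> complex" where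
  "conj_coord p x = complex_of_real (x $ 1 - p $ 1) - \<i> * complex_of_real (x $ 2 - p $ 2)"

text \<open>The square of the distance is polynomial, so a differentiable profile gives a function
  differentiable at \<open>p\<close> too. Moreover the Laplacian of \<open>H (sqdist p x)\<close> is
  \<open>4 (t H')'\<close>, and plane area becomes \<open>pi\<close> times length in
  \<open>t\<close>.\<close>

definition sqdist :: "real^2 \<Rightarrow> real^2 \<Rightarrow> real" where
  "sqdist p x = (x $ 1 - p $ 1)\<^sup>2 + (x $ 2 - p $ 2)\<^sup>2"

definition radial_field :: "real^2 \<Rightarrow> nat \<Rightarrow> real \<Rightarrow> (real \<Rightarrow> real) \<Rightarrow> real^2 \<Rightarrow> complex" where
  "radial_field p n A H x = complex_of_real (A * exp (H (sqdist p x))) * conj_coord p x ^ n"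

text \<open>This is \<open>(\<partial>\<^sub>2 h, - \<partial>\<^sub>1 h)\<close> for \<open>h x = H (sqdist p x)\<close> with \<open>H' = P\<close>.\<close>

definition radial_potential :: "real^2 \<Rightarrow> (real \<Rightarrow> real) \<Rightarrow> 2 \<Rightarrow> real^2 \<Rightarrow> real" where
  "radial_potential p P j x =
     (if j = 1 then 2 * (x $ 2 - p $ 2) * P (sqdist p x) else - 2 * (x $ 1 - p $ 1) * P (sqdist p x))"

lemma sqdist_eq: "sqdist p x = (norm (x - p))\<^sup>2"
  by (simp add: sqdist_def norm_vec_def L2_set_def sum_2)

lemma sqdist_nonneg: "sqdist p x \<ge> 0"
  by (simp add: sqdist_def)

lemma norm_conj_coord: "norm (conj_coord p x) = norm (x - p)"
  by (simp add: conj_coord_def cmod_def norm_vec_def L2_set_def sum_2) (rule power2_commute)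

lemma norm_radial_field: "A > 0 \<Longrightarrow> norm (radial_field p n A H x) = A * exp (H (sqdist p x)) * norm (x - p) ^ n"
  by (simp add: radial_field_def norm_mult norm_power norm_conj_coord)

lemma has_derivative_coord: "((\<lambda>x. x $ j - p $ j) has_derivative (\<lambda>v. v $ j)) (at x)"
  for p x :: "real^'n"
  using has_derivative_diff[OF bounded_linear_imp_has_derivative[OF bounded_linear_vec_nth[of j]]
          has_derivative_const[of "p $ j"]] by simp

lemma has_derivative_sqdist:
  "(sqdist p has_derivative (\<lambda>v. 2 * (x $ 1 - p $ 1) * v $ 1 + 2 * (x $ 2 - p $ 2) * v $ 2)) (at x)"
  unfolding sqdist_def[abs_def] power2_eq_square
  by (rule has_derivative_coord derivative_eq_intros refl)+ (simp add: algebra_simps)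

text \<open>A derivative relative to \<open>{0..}\<close> suffices, also at \<open>x = p\<close>,
  since \<open>sqdist p\<close> takes its values there.\<close>

lemma has_derivative_radial:
  assumes "(F has_real_derivative F') (at (sqdist p x) within {0..})"
  shows "((\<lambda>x. F (sqdist p x)) has_derivative
    (\<lambda>v. F' * (2 * (x $ 1 - p $ 1) * v $ 1 + 2 * (x $ 2 - p $ 2) * v $ 2))) (at x)"
proof -
  have "(F has_derivative (*) F') (at (sqdist p x) within range (sqdist p))"
    using assms by (rule has_derivative_subset[OF has_field_derivative_imp_has_derivative])
                   (auto simp: sqdist_nonneg)
  from has_derivative_in_compose[OF has_derivative_sqdist this] show ?thesis by simp
qed

lemma continuous_sqdist: "continuous_on S (sqdist p)"
  unfolding sqdist_def[abs_def] by (intro continuous_intros)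

lemma continuous_conj_coord: "continuous_on S (conj_coord p)"
  unfolding conj_coord_def[abs_def] by (intro continuous_intros)

lemma has_derivative_conj_coord:
  "(conj_coord p has_derivative (\<lambda>v. complex_of_real (v $ 1) - \<i> * complex_of_real (v $ 2))) (at x)"
  unfolding conj_coord_def[abs_def]
  by (rule has_derivative_coord derivative_eq_intros refl)+ simp

context
  fixes p :: "real^2" and H P Q :: "real \<Rightarrow> real"
  assumes H: "\<And>t. t \<ge> 0 \<Longrightarrow> (H has_real_derivative P t) (at t within {0..})"
    and P: "\<And>t. t \<ge> 0 \<Longrightarrow> (P has_real_derivative Q t) (at t within {0..})"
    and Q: "continuous_on {0..} Q"
begin

private lemma continuous_HP: "continuous_on {0..} H" "continuous_on {0..} P"
  using H P by (auto intro!: DERIV_continuous_on)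

private lemma continuous_radial:
  "continuous_on UNIV (\<lambda>x. H (sqdist p x))" "continuous_on UNIV (\<lambda>x. P (sqdist p x))"
  "continuous_on UNIV (\<lambda>x. Q (sqdist p x))"
  by (auto intro!: continuous_on_compose2[OF continuous_HP(1)] continuous_on_compose2[OF continuous_HP(2)]
        continuous_on_compose2[OF Q] continuous_sqdist simp: sqdist_nonneg)

private definition "field_deriv n A x v =
   complex_of_real (A * (exp (H (sqdist p x)) *
       (P (sqdist p x) * (2 * (x $ 1 - p $ 1) * v $ 1 + 2 * (x $ 2 - p $ 2) * v $ 2)))) * conj_coord p x ^ n +
   complex_of_real (A * exp (H (sqdist p x))) * (of_nat n * conj_coord p x ^ (n - 1) *
     (complex_of_real (v $ 1) - \<i> * complex_of_real (v $ 2)))" for v :: "real^2"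

private lemma has_derivative_radial_field:
  "(radial_field p n A H has_derivative field_deriv n A x) (at x)"
  unfolding radial_field_def[abs_def] field_deriv_def[abs_def]
  by (rule has_derivative_radial[OF H] has_derivative_conj_coord sqdist_nonneg derivative_eq_intros refl)+
     (simp add: algebra_simps)

private lemma has_derivative_radial_potential:
  "(radial_potential p P j has_derivative
     (\<lambda>v. let d = Q (sqdist p x) * (2 * (x $ 1 - p $ 1) * v $ 1 + 2 * (x $ 2 - p $ 2) * v $ 2) in
        if j = 1 then 2 * (v $ 2 * P (sqdist p x) + (x $ 2 - p $ 2) * d)
        else - 2 * (v $ 1 * P (sqdist p x) + (x $ 1 - p $ 1) * d))) (at x)"
proof (cases "j = 1")
  case True
  then have *: "radial_potential p P j = (\<lambda>x. 2 * (x $ 2 - p $ 2) * P (sqdist p x))"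
    by (auto simp: radial_potential_def)
  show ?thesis
    unfolding * Let_def if_P[OF True]
    by (rule has_derivative_coord has_derivative_radial[OF P] sqdist_nonneg derivative_eq_intros refl)+
       (simp add: algebra_simps)
next
  case False
  then have *: "radial_potential p P j = (\<lambda>x. - 2 * (x $ 1 - p $ 1) * P (sqdist p x))"
    by (auto simp: radial_potential_def)
  show ?thesis
    unfolding * Let_def if_not_P[OF False]
    by (rule has_derivative_coord has_derivative_radial[OF P] sqdist_nonneg derivative_eq_intros refl)+
       (simp add: algebra_simps)
qed

lemma C1_radial_field: "C1_on_plane (radial_field p n A H)"
  by (rule C1_on_planeI[OF has_derivative_radial_field])
     (auto simp: field_deriv_def intro!: continuous_intros continuous_radial continuous_conj_coord)

lemma C1_radial_potential: "C1_on_plane (radial_potential p P j)"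
  by (rule C1_on_planeI[OF has_derivative_radial_potential])
     (cases "j = 1"; auto simp: Let_def intro!: continuous_intros continuous_radial)

lemma curvature_radial_potential:
  "curvature (radial_potential p P) x = - 4 * (P (sqdist p x) + sqdist p x * Q (sqdist p x))"
  unfolding curvature_def partial_deriv_eq[OF has_derivative_radial_potential] Let_def
  by (simp add: algebra_simps power2_eq_square sqdist_def[of p x])

text \<open>With \<open>w = conj_coord p x\<close>, the derivative of \<open>H\<close> along the
  first axis and the potential term combine to \<open>2 P cnj w\<close>; along the second axis both
  this sum and the derivative of \<open>w ^ n\<close> are \<open>- \<i>\<close> times the former.
  The covariant Cauchy-Riemann equation thus holds for every profile. The truncated
  \<open>n - 1\<close> is harmless: its coefficient vanishes for \<open>n = 0\<close>.\<close>

lemma cov_deriv_radial: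
  "cov_deriv (radial_potential p P) 1 (radial_field p n A H) x =
     complex_of_real (A * exp (H (sqdist p x))) *
      (2 * complex_of_real (P (sqdist p x)) * cnj (conj_coord p x) * conj_coord p x ^ n
        + of_nat n * conj_coord p x ^ (n - 1))"
  "cov_deriv (radial_potential p P) 2 (radial_field p n A H) x =
     - \<i> * cov_deriv (radial_potential p P) 1 (radial_field p n A H) x"
  unfolding cov_deriv_def partial_deriv_eq[OF has_derivative_radial_field] field_deriv_def radial_field_def
    radial_potential_def
  by (simp_all add: conj_coord_def algebra_simps)

text \<open>Differentiation costs one factor \<open>1 / norm (x - p)\<close>, and the bracket is
  bounded as soon as \<open>t * P t\<close> is. This is how the exponent \<open>\<beta> + 1\<close>
  follows from \<open>\<beta>\<close>.\<close>

lemma norm_cov_deriv_radial_le: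
  assumes "A > 0" "x \<noteq> p"
  shows "norm (cov_deriv (radial_potential p P) j (radial_field p n A H) x) \<le>
     norm (radial_field p n A H x) / norm (x - p) * (2 * \<bar>sqdist p x * P (sqdist p x)\<bar> + real n)"
proof -
  let ?w = "conj_coord p x" and ?P = "P (sqdist p x)" and ?E = "A * exp (H (sqdist p x))" and ?s = "norm (x - p)"
  have s: "?s > 0" using assms by simp
  have "norm (cov_deriv (radial_potential p P) j (radial_field p n A H) x) =
        norm (cov_deriv (radial_potential p P) 1 (radial_field p n A H) x)"
    using exhaust_2[of j] by (auto simp: cov_deriv_radial(2) norm_mult)
  also have "\<dots> = ?E * norm (2 * complex_of_real ?P * cnj ?w * ?w ^ n + of_nat n * ?w ^ (n - 1))"
    unfolding cov_deriv_radial(1) norm_mult norm_of_real using assms by simp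
  also have "\<dots> \<le> ?E * (norm (2 * complex_of_real ?P * cnj ?w * ?w ^ n) + norm (of_nat n * ?w ^ (n - 1)))"
    using assms by (intro mult_left_mono norm_triangle_ineq) auto
  also have "\<dots> = ?E * (2 * \<bar>?P\<bar> * ?s * ?s ^ n + real n * ?s ^ (n - 1))"
    by (simp add: norm_mult norm_power norm_conj_coord)
  also have "real n * ?s ^ (n - 1) = real n * (?s ^ n / ?s)"
    using s by (cases n) auto
  also have "?E * (2 * \<bar>?P\<bar> * ?s * ?s ^ n + real n * (?s ^ n / ?s)) =
     (?E * ?s ^ n) / ?s * (2 * \<bar>?s\<^sup>2 * ?P\<bar> + real n)"
    using s by (simp add: field_simps power2_eq_square abs_mult)
  finally show ?thesis
    using assms by (simp add: norm_radial_field sqdist_eq)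
qed

lemma radial_field_zero_mult:
  assumes "A > 0" "n \<ge> 1"
  shows "radial_field p n A H x = 0 \<longleftrightarrow> x = p" "has_zero_of_mult (radial_field p n A H) p n"
proof -
  have iff: "radial_field p n A H x = 0 \<longleftrightarrow> x = p" for x
    using assms by (subst norm_eq_zero[symmetric]) (auto simp: norm_radial_field)
  then show "radial_field p n A H x = 0 \<longleftrightarrow> x = p" .
  show "has_zero_of_mult (radial_field p n A H) p n"
    unfolding has_zero_of_mult_def
    by (rule conjI, simp add: iff, rule exI[of _ UNIV], rule exI[of _ "\<lambda>x. A * exp (H (sqdist p x))"])
       (use assms in \<open>auto intro!: continuous_intros continuous_radial simp: norm_radial_field\<close>)
qed

end

subsection \<open>Concentration of radial densities\<close>

lemma borel_measurable_sqdist [measurable]: "sqdist p \<in> borel_measurable borel"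
  by (intro borel_measurable_continuous_onI continuous_sqdist)

text \<open>A disc of squared radius \<open>t\<close> has area \<open>pi * t\<close>, so both
  measures agree on the half lines \<open>{..t}\<close>, an intersection-stable generator. Radial
  integrals become one-dimensional without polar coordinates.\<close>

lemma distr_sqdist:
  "distr lborel borel (sqdist p) = density lborel (\<lambda>t. ennreal pi * indicator {0..} t)"
proof -
  have *: "sets borel = sigma_sets UNIV (range (\<lambda>t::real. {..t}))"
    by (subst borel_eq_atMost) (rule sets_measure_of, simp)
  show ?thesis
  proof (rule measure_eqI_generator_eq[where E = "range (\<lambda>t::real. {..t})" and \<Omega> = UNIV
          and A = "\<lambda>n. {..real n}"])
    show "Int_stable (range (\<lambda>t::real. {..t}))"
      by (auto simp: Int_stable_def Int_atMost)
    show "sets (distr lborel borel (sqdist p)) = sigma_sets UNIV (range atMost)"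
      "sets (density lborel (\<lambda>t::real. ennreal pi * indicator {0..} t)) = sigma_sets UNIV (range atMost)"
      by (simp_all only: sets_distr sets_density sets_lborel *)
    have 1: "emeasure (distr lborel borel (sqdist p)) {..t} = ennreal (pi * max 0 t)" for t
    proof -
      have "emeasure (distr lborel borel (sqdist p)) {..t} = emeasure lborel {x. sqdist p x \<le> t}"
        by (subst emeasure_distr) (auto simp: vimage_def)
      also have "\<dots> = ennreal (pi * max 0 t)"
      proof (cases "t \<ge> 0")
        case True
        then have "{x. sqdist p x \<le> t} = cball p (sqrt t)"
          by (auto simp: sqdist_eq dist_norm norm_minus_commute real_le_rsqrt sqrt_ge_absD
                   dest: real_sqrt_le_mono)
        then show ?thesis using True by (simp add: emeasure_cball unit_ball_vol_2)
      next
        case False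
        have "sqdist p x \<ge> 0" for x by (rule sqdist_nonneg)
        then have "{x. sqdist p x \<le> t} = {}" using False by (auto dest: order_trans)
        then show ?thesis using False by simp
      qed
      finally show ?thesis .
    qed
    have 2: "emeasure (density lborel (\<lambda>t. ennreal pi * indicator {0..} t)) {..t} = ennreal (pi * max 0 t)" for t
    proof -
      have "emeasure (density lborel (\<lambda>t. ennreal pi * indicator {0..} t)) {..t} =
         (\<integral>\<^sup>+s. ennreal pi * indicator {0..t} s \<partial>lborel)"
        by (subst emeasure_density) (auto intro!: nn_integral_cong simp: indicator_def)
      also have "\<dots> = ennreal pi * emeasure lborel {0..t}"
        by (simp add: nn_integral_cmult_indicator)
      also have "\<dots> = ennreal (pi * max 0 t)"
        by (cases "t \<ge> 0") (auto simp: ennreal_mult)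
      finally show ?thesis .
    qed
    show "emeasure (distr lborel borel (sqdist p)) X =
        emeasure (density lborel (\<lambda>t. ennreal pi * indicator {0..} t)) X" if "X \<in> range atMost" for X
      using that 1 2 by auto
    show "emeasure (distr lborel borel (sqdist p)) {..real i} \<noteq> \<infinity>" for i
      by (simp add: 1)
    show "(\<Union>i. {..real i}) = UNIV" using real_arch_simple by auto
  qed auto
qed

lemma has_bochner_integral_radial:
  assumes f: "f \<in> borel_measurable borel"
    and F: "\<And>t. t \<ge> 0 \<Longrightarrow> (F has_real_derivative f t) (at t)"
    and nonneg: "\<And>t. t \<ge> 0 \<Longrightarrow> f t \<ge> 0"
    and lim: "(F \<longlongrightarrow> T) at_top"
  shows "has_bochner_integral lborel (\<lambda>x. f (sqdist p x)) (pi * (T - F 0))"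
proof -
  have "(\<integral>\<^sup>+x. ennreal (f (sqdist p x)) \<partial>lborel) = (\<integral>\<^sup>+t. ennreal (f t) \<partial>distr lborel borel (sqdist p))"
    using f by (subst nn_integral_distr) auto
  also have "\<dots> = (\<integral>\<^sup>+t. ennreal pi * (ennreal (f t) * indicator {0..} t) \<partial>lborel)"
    unfolding distr_sqdist using f
    by (subst nn_integral_density) (auto intro!: nn_integral_cong simp: mult_ac)
  also have "\<dots> = ennreal pi * ennreal (T - F 0)"
    using f nn_integral_FTC_atLeast[OF f F nonneg lim] by (subst nn_integral_cmult) auto
  also have "\<dots> = ennreal (pi * (T - F 0))"
    by (simp add: ennreal_mult')
  finally have *: "(\<integral>\<^sup>+x. ennreal (f (sqdist p x)) \<partial>lborel) = ennreal (pi * (T - F 0))" .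
  have "F 0 \<le> T"
  proof (rule tendsto_lowerbound[OF lim])
    have "F 0 \<le> F t" if "t > 0" for t
      using that DERIV_nonneg_imp_nondecreasing[of 0 t F] F nonneg by (meson less_imp_le)
    then show "\<forall>\<^sub>F t in at_top. F 0 \<le> F t"
      by (intro eventually_mono[OF eventually_gt_at_top[of 0]])
  qed simp
  then show ?thesis
    using f * nonneg sqdist_nonneg by (intro has_bochner_integral_nn_integral) auto
qed

lemma integral_lborel_affine:
  fixes f :: "'a::euclidean_space \<Rightarrow> real"
  assumes "c \<noteq> 0" "f \<in> borel_measurable borel"
  shows "integral\<^sup>L lborel f = \<bar>c\<bar> ^ DIM('a) * (LINT x|lborel. f (t + c *\<^sub>R x))"
    "integrable lborel f \<longleftrightarrow> integrable lborel (\<lambda>x. f (t + c *\<^sub>R x))"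
  using assms
  by (subst lborel_affine[OF assms(1), of t];
      simp add: integral_density integrable_density integral_distr integrable_distr_eq)+

lemma integrable_decay:
  "integrable lborel (\<lambda>x. (1 + sqdist p x) powr (-5/4))"
proof -
  have "((\<lambda>t::real. -4 * (1 + t) powr (-1/4)) \<longlongrightarrow> 0) at_top"
    by (rule tendsto_eq_intros tendsto_neg_powr filterlim_tendsto_add_at_top filterlim_ident tendsto_const
         refl | simp)+
  moreover have "((\<lambda>t. -4 * (1 + t) powr (-1/4)) has_real_derivative (1 + t) powr (-5/4)) (at t)"
    if "t \<ge> 0" for t :: real
    using that by (auto intro!: derivative_eq_intros)
  ultimately have "has_bochner_integral lborel (\<lambda>x. (1 + sqdist p x) powr (-5/4))
      (pi * (0 - (-4 * (1 + 0) powr (-1/4))))"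
    by (intro has_bochner_integral_radial) auto
  then show ?thesis by (rule integrable.intros)
qed

text \<open>With \<open>x = p + \<epsilon> y\<close> the Jacobian \<open>\<epsilon>^2\<close>
  cancels the prefactor of \<open>f\<close>. The density turns into \<open>Z \<epsilon>\<close> at
  \<open>|y|^2\<close>, and the test function into \<open>\<psi> (p + \<epsilon> y)\<close>, which
  tends to \<open>\<psi> p\<close>. The majorant \<open>(C + 1) * (1 + t) powr (-5/4)\<close> is
  integrable in \<open>t\<close>, hence over the plane, so no mass escapes.\<close>

lemma concentration:
  fixes Z :: "real \<Rightarrow> real \<Rightarrow> real" and p :: "real^2"
  assumes \<epsilon>0: "\<epsilon>0 > 0"
    and cont: "\<And>\<epsilon>. \<epsilon> \<in> {0<..<\<epsilon>0} \<Longrightarrow> continuous_on {0..} (Z \<epsilon>)"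
    and close: "\<And>\<epsilon> t. \<epsilon> \<in> {0<..<\<epsilon>0} \<Longrightarrow> t \<ge> 0 \<Longrightarrow> \<bar>Z \<epsilon> t - Z0 t\<bar> \<le> \<eta> \<epsilon> * (1 + t) powr (-5/4)"
    and \<eta>: "(\<eta> \<longlongrightarrow> 0) (at_right 0)" "\<And>\<epsilon>. \<epsilon> \<in> {0<..<\<epsilon>0} \<Longrightarrow> \<eta> \<epsilon> \<le> 1"
    and Z0: "\<And>t. t \<ge> 0 \<Longrightarrow> \<bar>Z0 t\<bar> \<le> C * (1 + t) powr (-5/4)" 
    and int: "has_bochner_integral lborel (\<lambda>y. Z0 (sqdist (0::real^2) y)) I"
  defines "f \<equiv> (\<lambda>\<epsilon> x. 1 / \<epsilon>\<^sup>2 * Z \<epsilon> (sqdist p x / \<epsilon>\<^sup>2))"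
  shows "\<epsilon> \<in> {0<..<\<epsilon>0} \<Longrightarrow> integrable lborel (f \<epsilon>)"
    and "weakly_tendsto_dirac f I p (at_right 0)"
proof -
  let ?D = "\<lambda>t::real. (1 + t) powr (-5/4)"
  have Zm [measurable]: "(\<lambda>x. Z \<epsilon> (sqdist q x / a)) \<in> borel_measurable borel"
    if "\<epsilon> \<in> {0<..<\<epsilon>0}" "a > 0" for \<epsilon> q a
    using that
    by (intro borel_measurable_continuous_onI continuous_on_compose2[OF cont] continuous_intros continuous_sqdist)
       (auto simp: sqdist_nonneg)
  have scale: "sqdist p (p + \<epsilon> *\<^sub>R y) / \<epsilon>\<^sup>2 = sqdist 0 y" if "\<epsilon> > 0" for \<epsilon> y
    using that by (simp add: sqdist_eq power_mult_distrib)
  have Zle: "\<bar>Z \<epsilon> t\<bar> \<le> (C + 1) * ?D t" if "\<epsilon> \<in> {0<..<\<epsilon>0}" "t \<ge> 0" for \<epsilon> t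
  proof -
    have "\<bar>Z \<epsilon> t\<bar> \<le> \<bar>Z \<epsilon> t - Z0 t\<bar> + \<bar>Z0 t\<bar>" by linarith
    also have "\<dots> \<le> 1 * ?D t + C * ?D t"
      using that by (intro add_mono Z0 order_trans[OF close] mult_right_mono \<eta>(2)) auto
    finally show ?thesis by (simp add: algebra_simps)
  qed
  have fm: "f \<epsilon> \<in> borel_measurable borel" if "\<epsilon> \<in> {0<..<\<epsilon>0}" for \<epsilon>
    unfolding f_def using Zm[OF that, of "\<epsilon>\<^sup>2" p] that by simp
  have fe: "f \<epsilon> (p + \<epsilon> *\<^sub>R y) = 1 / \<epsilon>\<^sup>2 * Z \<epsilon> (sqdist 0 y)" if "\<epsilon> > 0" for \<epsilon> y
    unfolding f_def scale[OF that] ..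
  show "integrable lborel (f \<epsilon>)" if \<epsilon>: "\<epsilon> \<in> {0<..<\<epsilon>0}"
  proof -
    have "integrable lborel (\<lambda>y. Z \<epsilon> (sqdist 0 y))"
      by (rule Bochner_Integration.integrable_bound[OF integrable_mult_right[OF integrable_decay[of 0], of "C + 1"]])
         (use Zm[OF \<epsilon>, of 1 0] order_trans[OF Zle[OF \<epsilon> sqdist_nonneg] abs_ge_self] in auto)
    then show ?thesis
      using \<epsilon> by (subst integral_lborel_affine(2)[OF _ fm[OF \<epsilon>], of \<epsilon> p]) (auto simp: fe)
  qed
  show "weakly_tendsto_dirac f I p (at_right 0)"
    unfolding weakly_tendsto_dirac_def
  proof (intro allI impI, elim conjE)
    fix \<psi> :: "real^2 \<Rightarrow> real" assume \<psi>: "continuous_on UNIV \<psi>" "bounded (range \<psi>)"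
    then obtain B where B: "\<And>x. \<bar>\<psi> x\<bar> \<le> B" by (auto simp: bounded_iff)
    have \<psi>m [measurable]: "\<psi> \<in> borel_measurable borel" by (rule borel_measurable_continuous_onI[OF \<psi>(1)])
    have eq: "(LINT x|lborel. f \<epsilon> x * \<psi> x) = (LINT y|lborel. Z \<epsilon> (sqdist 0 y) * \<psi> (p + \<epsilon> *\<^sub>R y))"
      if \<epsilon>: "\<epsilon> \<in> {0<..<\<epsilon>0}" for \<epsilon>
    proof -
      have "(LINT x|lborel. f \<epsilon> x * \<psi> x) =
          \<epsilon>\<^sup>2 * (LINT y|lborel. f \<epsilon> (p + \<epsilon> *\<^sub>R y) * \<psi> (p + \<epsilon> *\<^sub>R y))"
        using \<epsilon> by (subst integral_lborel_affine(1)[of \<epsilon> _ p]) (auto intro!: borel_measurable_times fm)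
      also have "\<dots> = (LINT y|lborel. \<epsilon>\<^sup>2 * (f \<epsilon> (p + \<epsilon> *\<^sub>R y) * \<psi> (p + \<epsilon> *\<^sub>R y)))"
        by simp
      also have "\<dots> = (LINT y|lborel. Z \<epsilon> (sqdist 0 y) * \<psi> (p + \<epsilon> *\<^sub>R y))"
        using \<epsilon> by (intro Bochner_Integration.integral_cong) (auto simp: fe)
      finally show ?thesis .
    qed
    \<comment> \<open>Dominated convergence speaks of sequences, so the limit is taken along
      sequences in the admissible interval; the filter is changed to \<open>at_right 0\<close>
      afterwards.\<close>
    have "((\<lambda>\<epsilon>. LINT x|lborel. f \<epsilon> x * \<psi> x) \<longlongrightarrow> I * \<psi> p) (at 0 within {0<..<\<epsilon>0})"
      unfolding tendsto_at_iff_sequentially comp_def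
    proof (intro allI impI)
      fix X :: "nat \<Rightarrow> real"
      assume X: "\<forall>i. X i \<in> {0<..<\<epsilon>0} - {0}" and lim: "X \<longlonglongrightarrow> 0"
      then have X': "X i \<in> {0<..<\<epsilon>0}" for i by auto
      have "filterlim X (at_right 0) sequentially"
        using X lim by (auto simp: filterlim_at less_imp_neq[THEN not_sym] intro!: always_eventually)
      then have \<eta>X: "(\<lambda>i. \<eta> (X i)) \<longlonglongrightarrow> 0" by (rule filterlim_compose[OF \<eta>(1)])
      have ptw: "(\<lambda>i. Z (X i) t) \<longlonglongrightarrow> Z0 t" if "t \<ge> 0" for t
      proof (rule LIM_zero_cancel, rule tendsto_0_le[of _ _ _ "?D t"])
        show "(\<lambda>i. \<eta> (X i)) \<longlonglongrightarrow> 0" by fact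
        show "\<forall>\<^sub>F i in sequentially. norm (Z (X i) t - Z0 t) \<le> norm (\<eta> (X i)) * ?D t"
        proof (intro always_eventually allI)
          fix i
          have "norm (Z (X i) t - Z0 t) \<le> \<eta> (X i) * ?D t" using close[OF X' that] by simp
          also have "\<dots> \<le> norm (\<eta> (X i)) * ?D t" by (intro mult_right_mono) auto
          finally show "norm (Z (X i) t - Z0 t) \<le> norm (\<eta> (X i)) * ?D t" .
        qed
      qed
      have "(\<lambda>i. LINT y|lborel. Z (X i) (sqdist 0 y) * \<psi> (p + X i *\<^sub>R y))
          \<longlonglongrightarrow> (LINT y|lborel. Z0 (sqdist 0 y) * \<psi> p)"
      proof (rule integral_dominated_convergence[where w = "\<lambda>y. ((C + 1) * ?D (sqdist 0 y)) * B"])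
        show "(\<lambda>y. Z0 (sqdist 0 y) * \<psi> p) \<in> borel_measurable lborel"
          using int by (intro borel_measurable_times) (auto simp: has_bochner_integral_iff)
        show "(\<lambda>y. Z (X i) (sqdist 0 y) * \<psi> (p + X i *\<^sub>R y)) \<in> borel_measurable lborel" for i
          using Zm[OF X'[of i], of 1 0] by simp
        show "integrable lborel (\<lambda>y. ((C + 1) * ?D (sqdist 0 y)) * B)"
          by (intro integrable_mult_left integrable_mult_right integrable_decay)
        show "AE y in lborel. (\<lambda>i. Z (X i) (sqdist 0 y) * \<psi> (p + X i *\<^sub>R y))
            \<longlonglongrightarrow> Z0 (sqdist 0 y) * \<psi> p"
        proof (intro AE_I2 tendsto_mult ptw sqdist_nonneg)
          fix y
          have "(\<lambda>i. p + X i *\<^sub>R y) \<longlonglongrightarrow> p"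
            using tendsto_add[OF tendsto_const[of p] tendsto_scaleR[OF lim tendsto_const[of y]]] by simp
          then show "(\<lambda>i. \<psi> (p + X i *\<^sub>R y)) \<longlonglongrightarrow> \<psi> p"
            using \<psi>(1) continuous_on_tendsto_compose[of UNIV \<psi>] by auto
        qed
        show "AE y in lborel. norm (Z (X i) (sqdist 0 y) * \<psi> (p + X i *\<^sub>R y))
            \<le> ((C + 1) * ?D (sqdist 0 y)) * B" for i
        proof (rule AE_I2)
          fix y
          have "\<bar>Z (X i) (sqdist 0 y)\<bar> * \<bar>\<psi> (p + X i *\<^sub>R y)\<bar> \<le> ((C + 1) * ?D (sqdist 0 y)) * B"
            by (rule mult_mono[OF Zle[OF X' sqdist_nonneg] B])
               (use Zle[OF X'[of i] sqdist_nonneg[of 0 y]] in auto)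
          then show "norm (Z (X i) (sqdist 0 y) * \<psi> (p + X i *\<^sub>R y)) \<le> ((C + 1) * ?D (sqdist 0 y)) * B"
            by (simp add: abs_mult)
        qed
      qed
      then show "(\<lambda>i. LINT x|lborel. f (X i) x * \<psi> x) \<longlonglongrightarrow> I * \<psi> p"
        using int by (simp add: eq[OF X'] has_bochner_integral_iff)
    qed
    then show "((\<lambda>\<epsilon>. LINT x|lborel. f \<epsilon> x * \<psi> x) \<longlongrightarrow> I * \<psi> p) (at_right 0)"
    proof -
      have "at 0 within {0<..<\<epsilon>0} = at_right 0"
        by (rule at_within_nhd[of _ "{..<\<epsilon>0}"]) (use \<epsilon>0 in auto)
      then show ?thesis using \<open>(_ \<longlongrightarrow> _) (at 0 within {0<..<\<epsilon>0})\<close> by simp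
    qed
  qed
qed

subsection \<open>The self-dual configurations\<close>

lemma scaled_radial_derivative:
  fixes s :: real
  assumes "(F has_real_derivative F') (at (s * t) within {0..})" "s > 0"
  shows "((\<lambda>t. F (s * t)) has_real_derivative F' * s) (at t within {0..})"
proof (rule DERIV_image_chain[of F F' "\<lambda>t. s * t", unfolded comp_def])
  show "(F has_real_derivative F') (at (s * t) within (*) s ` {0..})"
    by (rule DERIV_subset[OF assms(1)]) (use assms(2) in auto)
  show "((*) s has_real_derivative s) (at t within {0..})"
    by (auto intro!: derivative_eq_intros)
qed

text \<open>Far out \<open>norm (x - p) \<ge> norm x / 2\<close>, and the nonpositive power reverses
  this, at the price of a factor \<open>2 powr (2 * b)\<close>. Decay around \<open>p\<close> thus
  passes to decay around the origin.\<close>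

lemma bigo_at_infinity_shift:
  fixes F :: "real^2 \<Rightarrow> real"
  assumes le: "\<And>x. norm (x - p) \<ge> r \<Longrightarrow> \<bar>F x\<bar> \<le> C * norm (x - p) powr (- 2 * b)"
    and "b \<ge> 0"
  shows "F \<in> O[at_infinity](\<lambda>x. norm x powr (- 2 * b))"
proof (rule bigoI)
  have "\<forall>\<^sub>F x in at_infinity. norm (x::real^2) \<ge> 2 * norm p + 2 * \<bar>r\<bar> + 1"
    by (auto simp: eventually_at_infinity)
  then show "\<forall>\<^sub>F x in at_infinity. norm (F x) \<le> (\<bar>C\<bar> * 2 powr (2 * b)) * norm (norm x powr (- 2 * b))"
  proof eventually_elim
    case (elim x)
    have "norm x \<le> norm (x - p) + norm p" by (metis diff_add_cancel norm_triangle_ineq)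
    then have x: "norm x / 2 \<le> norm (x - p)" "r \<le> norm (x - p)" "norm x / 2 > 0"
      using elim norm_ge_zero[of p] by linarith+
    have "\<bar>F x\<bar> \<le> \<bar>C\<bar> * norm (x - p) powr (- 2 * b)"
      using le[OF x(2)] by (rule order_trans) (auto intro: mult_right_mono)
    also have "\<dots> \<le> \<bar>C\<bar> * (norm x / 2) powr (- 2 * b)"
      using x \<open>b \<ge> 0\<close> by (intro mult_left_mono powr_mono2') auto
    also have "(norm x / 2) powr (- 2 * b) = 2 powr (2 * b) * norm x powr (- 2 * b)"
    proof -
      have "2 powr (2 * b) * 2 powr (- 2 * b) = (1::real)" by (simp flip: powr_add)
      moreover have "norm x powr (- 2 * b) = 2 powr (- 2 * b) * (norm x / 2) powr (- 2 * b)"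
        by (simp flip: powr_mult)
      ultimately show ?thesis by simp
    qed
    finally show ?case by simp
  qed
qed

text \<open>The exact solution that is perturbed. The last identity is the derivative of
  \<open>t h' = - (M / 2) * t ^ M / (1 + t ^ M)\<close>, with \<open>h\<close> the first function;
  it is split into \<open>h' + t h''\<close> because the curvature of a radial potential has that
  form.\<close>

lemma liouville_profile_derivatives:
  fixes m :: nat
  defines "M \<equiv> Suc m"
  assumes "t \<ge> 0"
  shows "((\<lambda>t. - (1/2) * ln (1 + t ^ M)) has_real_derivative - (real M / 2) * rational_weight M m t) (at t within {0..})"
    "((\<lambda>t. - (real M / 2) * rational_weight M m t) has_real_derivative
       - (real M / 2) * ((real m * t ^ (m - 1) * (1 + t ^ M) - t ^ m * (real M * t ^ m)) / (1 + t ^ M)\<^sup>2))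
      (at t within {0..})"
    "- (real M / 2) * rational_weight M m t + t * (- (real M / 2) *
       ((real m * t ^ (m - 1) * (1 + t ^ M) - t ^ m * (real M * t ^ m)) / (1 + t ^ M)\<^sup>2)) =
      - (real M ^ 2 / 2 * (t ^ m / (1 + t ^ M)\<^sup>2))"
proof -
  have pos: "1 + t ^ M > 0" using assms by (intro one_plus_power_pos)
  then show "((\<lambda>t. - (1/2) * ln (1 + t ^ M)) has_real_derivative - (real M / 2) * rational_weight M m t) (at t within {0..})"
    by (auto intro!: derivative_eq_intros simp: rational_weight_def M_def field_simps simp del: power_Suc)
  have "((\<lambda>t. t ^ m / (1 + t ^ M)) has_real_derivative
      (real m * t ^ (m - 1) * (1 + t ^ M) - t ^ m * (real M * t ^ m)) / (1 + t ^ M)\<^sup>2) (at t within {0..})"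
    using pos by (auto intro!: derivative_eq_intros simp: M_def power2_eq_square simp del: power_Suc)
  from DERIV_cmult[OF this, of "- (real M / 2)"]
  show "((\<lambda>t. - (real M / 2) * rational_weight M m t) has_real_derivative
       - (real M / 2) * ((real m * t ^ (m - 1) * (1 + t ^ M) - t ^ m * (real M * t ^ m)) / (1 + t ^ M)\<^sup>2))
      (at t within {0..})"
    unfolding rational_weight_def .
  \<comment> \<open>For \<open>m = 0\<close> the exponent \<open>m - 1\<close> is truncated, but
    then the coefficient \<open>real m\<close> is zero.\<close>
  have tm: "t * (real m * t ^ (m - 1)) = real m * t ^ m" by (cases m) auto
  have "t * (real m * t ^ (m - 1) * (1 + t ^ M) - t ^ m * (real M * t ^ m)) =
      t * (real m * t ^ (m - 1)) * (1 + t ^ M) - t * (t ^ m * (real M * t ^ m))"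
    by (simp only: right_diff_distrib mult.assoc)
  also have "\<dots> = real m * t ^ m * (1 + t ^ M) - real M * t ^ m * t ^ M"
    unfolding tm by (simp add: M_def)
  finally have "t * (real m * t ^ (m - 1) * (1 + t ^ M) - t ^ m * (real M * t ^ m)) =
      real m * t ^ m * (1 + t ^ M) - real M * t ^ m * t ^ M" .
  moreover have "rational_weight M m t = t ^ m * (1 + t ^ M) / (1 + t ^ M)\<^sup>2"
    using pos by (simp add: rational_weight_def power2_eq_square)
  ultimately have "rational_weight M m t + t * ((real m * t ^ (m - 1) * (1 + t ^ M) - t ^ m * (real M * t ^ m)) / (1 + t ^ M)\<^sup>2)
      = (t ^ m * (1 + t ^ M) + (real m * t ^ m * (1 + t ^ M) - real M * t ^ m * t ^ M)) / (1 + t ^ M)\<^sup>2"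
    by (simp add: add_divide_distrib)
  also have "t ^ m * (1 + t ^ M) + (real m * t ^ m * (1 + t ^ M) - real M * t ^ m * t ^ M) = real M * t ^ m"
    by (simp add: M_def algebra_simps)
  finally have eq: "rational_weight M m t + t * ((real m * t ^ (m - 1) * (1 + t ^ M) - t ^ m * (real M * t ^ m)) / (1 + t ^ M)\<^sup>2)
      = real M * t ^ m / (1 + t ^ M)\<^sup>2" .
  have distrib: "- (real M / 2) * x + t * (- (real M / 2) * y) = - (real M / 2) * (x + t * y)" for x y :: real
    by (simp add: algebra_simps)
  show "- (real M / 2) * rational_weight M m t + t * (- (real M / 2) *
       ((real m * t ^ (m - 1) * (1 + t ^ M) - t ^ m * (real M * t ^ m)) / (1 + t ^ M)\<^sup>2)) =
      - (real M ^ 2 / 2 * (t ^ m / (1 + t ^ M)\<^sup>2))"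
    unfolding distrib eq by (simp add: power2_eq_square)
qed

definition component :: "2 \<Rightarrow> real \<times> real \<Rightarrow> real" where
  "component i u = (if i = 1 then fst u else snd u)"

lemma bounded_linear_component: "bounded_linear (component i)"
  unfolding component_def by (cases "i = 1") (auto simp: bounded_linear_fst bounded_linear_snd)

lemma abs_component_le: "\<bar>component i u\<bar> \<le> norm u"
  by (auto simp: component_def abs_fst_le abs_snd_le)

lemma component_has_real_derivative:
  assumes "(g has_vector_derivative g') (at t within S)"
  shows "((\<lambda>t. component i (g t)) has_real_derivative component i g') (at t within S)"
  using bounded_linear.has_vector_derivative[OF bounded_linear_component assms]
  by (simp add: has_real_derivative_iff_has_vector_derivative)

lemma self_dual_configuration:
  fixes k \<sigma> \<epsilon> d :: real and N1 N2 :: nat and p :: "real^2"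
  defines "M \<equiv> Suc (N1 + N2)"
  defines "n \<equiv> (\<lambda>i::2. if i = 1 then N1 else N2)"
  assumes "k > 0" "\<sigma> > 0" "\<epsilon> > 0" and N: "N1 \<ge> 1" "N2 \<ge> 1" and d: "0 \<le> d" "d \<le> 1/40"
    and cont: "continuous_on {0..} Q"
    and f: "\<And>t. t \<ge> 0 \<Longrightarrow> f t = source (real M ^ 2 / 2 * (rational_weight M N1 t * rational_weight M N2 t))
        (real M * \<sigma> / 2 * \<epsilon> * rational_weight M N1 t) (real M * \<sigma> / 2 * \<epsilon> * rational_weight M N2 t) (g t)"
    and g: "\<And>t. t \<ge> 0 \<Longrightarrow> (g has_vector_derivative P t) (at t within {0..})"
    and P: "\<And>t. t \<ge> 0 \<Longrightarrow> (P has_vector_derivative Q t) (at t within {0..})"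
    and PQ: "\<And>t. t \<ge> 0 \<Longrightarrow> P t + t *\<^sub>R Q t = f t"
    and Ple: "\<And>t. t \<ge> 0 \<Longrightarrow> norm (P t) \<le> d / (1 + t)"
    and gle: "\<And>t. t \<ge> 0 \<Longrightarrow> norm (g t) \<le> d * ln (1 + t)"
  shows "\<exists>a \<phi>. self_dual_solution k \<sigma> a \<phi> \<and> (\<forall>i x. \<phi> i x = 0 \<longleftrightarrow> x = p) \<and>
     (\<forall>i. has_zero_of_mult (\<phi> i) p (n i)) \<and>
     (\<forall>i. (\<lambda>x. (norm (\<phi> i x))\<^sup>2) \<in> O[at_infinity](\<lambda>x. norm x powr (- 2 * (real (M - n i) - 2 * d)))) \<and>
     (\<forall>i j. (\<lambda>x. (norm (cov_deriv (a i) j (\<phi> i) x))\<^sup>2)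
                \<in> O[at_infinity](\<lambda>x. norm x powr (- 2 * (real (M - n i) - 2 * d + 1)))) \<and>
     (\<forall>i x. curvature (a i) x = 1 / \<epsilon>\<^sup>2 *
        (4 * (real M ^ 2 / 2 * (rational_weight M N1 (sqdist p x / \<epsilon>\<^sup>2) * rational_weight M N2 (sqdist p x / \<epsilon>\<^sup>2))
           - component i (f (sqdist p x / \<epsilon>\<^sup>2)))))"
proof -
  define m where "m = N1 + N2"
  define s where "s = 1 / \<epsilon>\<^sup>2"
  have s: "s > 0" using \<open>\<epsilon> > 0\<close> by (simp add: s_def)
  \<comment> \<open>Fixed by matching the quartic term with the Liouville density,
    \<open>8 * pi^2 / k^2 * B^2 = 2 * M^2\<close>. The quadratic term then gets the coefficient
    \<open>4 * (M * \<sigma> / 2)\<close>, the source of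
    \<open>real M * \<sigma> / 2 * \<epsilon>\<close> in the equation for \<open>f\<close>.\<close>
  define B where "B = real M * k / (2 * pi)"
  have B: "B > 0" using \<open>k > 0\<close> by (simp add: B_def M_def)
  define P0 where "P0 t = - (real M / 2) * rational_weight M m t" for t
  define Q0 where "Q0 t = - (real M / 2) *
    ((real m * t ^ (m - 1) * (1 + t ^ M) - t ^ m * (real M * t ^ m)) / (1 + t ^ M)\<^sup>2)" for t
  have Mm: "M = Suc m" by (simp add: M_def m_def)
  note profile = liouville_profile_derivatives[of _ m, folded Mm, folded Q0_def, folded P0_def]
  have wt12: "rational_weight M N1 t * rational_weight M N2 t = t ^ m / (1 + t ^ M)\<^sup>2" for t
    by (simp add: rational_weight_def m_def power_add power2_eq_square)
  define h where "h i t = - (1/2) * ln (1 + t ^ M) + component i (g t)" for i t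
  define H where "H i t = h i (s * t)" for i t
  define HP where "HP i t = (P0 (s * t) + component i (P (s * t))) * s" for i t
  define HQ where "HQ i t = (Q0 (s * t) + component i (Q (s * t))) * s * s" for i t
  have H: "(H i has_real_derivative HP i t) (at t within {0..})" if "t \<ge> 0" for i t
    unfolding H_def[abs_def] h_def[abs_def] HP_def using that s
    by (intro scaled_radial_derivative DERIV_add profile(1) component_has_real_derivative g) auto
  have HP: "(HP i has_real_derivative HQ i t) (at t within {0..})" if "t \<ge> 0" for i t
    unfolding HP_def[abs_def] HQ_def using that s
    by (intro DERIV_cmult_right scaled_radial_derivative[where F = "\<lambda>t. P0 t + component i (P t)"]
          DERIV_add profile(2) component_has_real_derivative P) auto
  have HQ: "continuous_on {0..} (HQ i)" for i
    unfolding HQ_def[abs_def] Q0_def using s one_plus_power_pos[of _ M]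
    by (intro continuous_intros continuous_on_compose2[OF cont]
          bounded_linear.continuous_on[OF bounded_linear_component]) 
       (auto simp: less_imp_neq[THEN not_sym])
  \<comment> \<open>The denominator turns the factor \<open>sqdist p x ^ n i\<close> of the squared
    modulus into \<open>\<tau> x ^ n i\<close>, so that \<open>|phi_i|^2\<close> is
    \<open>B / \<epsilon>\<close> times a function of the rescaled variable.\<close>
  define A where "A i = sqrt (B / \<epsilon>) / \<epsilon> ^ n i" for i
  have A: "A i > 0" for i using B \<open>\<epsilon> > 0\<close> by (simp add: A_def)
  define \<phi> where "\<phi> i = radial_field p (n i) (A i) (H i)" for i
  define a where "a i = radial_potential p (HP i)" for i
  have n: "n i \<ge> 1" "n i < M" for i using N by (auto simp: n_def M_def)
  define \<tau> where "\<tau> x = s * sqdist p x" for x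
  have \<tau>0: "\<tau> x \<ge> 0" for x using s by (simp add: \<tau>_def sqdist_nonneg)
  have V: "(norm (\<phi> i x))\<^sup>2 = B / \<epsilon> * (rational_weight M (n i) (\<tau> x) * exp (2 * component i (g (\<tau> x))))" for i x
  proof -
    have pos: "1 + \<tau> x ^ M > 0" using \<tau>0 by (rule one_plus_power_pos)
    have "(norm (\<phi> i x))\<^sup>2 = (A i)\<^sup>2 * (exp (H i (sqdist p x)))\<^sup>2 * sqdist p x ^ n i"
      using A by (simp add: \<phi>_def norm_radial_field power_mult_distrib sqdist_eq mult.commute flip: power_mult)
    also have "(A i)\<^sup>2 = B / \<epsilon> * s ^ n i"
      using B \<open>\<epsilon> > 0\<close> by (simp add: A_def s_def power_divide mult.commute flip: power_mult)
    also have "(exp (H i (sqdist p x)))\<^sup>2 = exp (2 * component i (g (\<tau> x))) / (1 + \<tau> x ^ M)"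
    proof -
      have "(exp (H i (sqdist p x)))\<^sup>2 = exp (2 * component i (g (\<tau> x)) - ln (1 + \<tau> x ^ M))"
        by (subst exp_double[symmetric]) (simp add: H_def h_def \<tau>_def)
      then show ?thesis using pos by (simp add: exp_diff)
    qed
    finally show ?thesis
      by (simp add: rational_weight_def \<tau>_def power_mult_distrib)
  qed
  have curv: "curvature (a i) x = 4 * s *
        (real M ^ 2 / 2 * (rational_weight M N1 (\<tau> x) * rational_weight M N2 (\<tau> x)) - component i (f (\<tau> x)))" for i x
  proof -
    have "component i (f (\<tau> x)) = component i (P (\<tau> x)) + \<tau> x * component i (Q (\<tau> x))"
      unfolding PQ[OF \<tau>0, symmetric] by (simp add: component_def)
    moreover have "curvature (a i) x = - 4 * (HP i (sqdist p x) + sqdist p x * HQ i (sqdist p x))"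
      unfolding a_def by (rule curvature_radial_potential[OF H HP HQ])
    ultimately have "curvature (a i) x = - 4 * s * ((P0 (\<tau> x) + \<tau> x * Q0 (\<tau> x)) + component i (f (\<tau> x)))"
      by (simp add: HP_def HQ_def \<tau>_def algebra_simps)
    then show ?thesis
      unfolding profile(3)[OF \<tau>0] wt12 by (simp add: algebra_simps)
  qed
  have K: "8 * pi\<^sup>2 / k\<^sup>2 * B\<^sup>2 = 2 * real M ^ 2" "8 * pi\<^sup>2 / k\<^sup>2 * B * c_squared k \<sigma> = 4 * (real M * \<sigma> / 2)"
    using \<open>k > 0\<close> by (simp_all add: B_def c_squared_def power2_eq_square field_simps)
  have sd1: "curvature (a 1) x =
     8 * pi\<^sup>2 / k\<^sup>2 * (norm (\<phi> 2 x))\<^sup>2 * ((norm (\<phi> 1 x))\<^sup>2 + c_squared k \<sigma>)" for x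
  proof -
    define w1 w2 where "w1 = rational_weight M N1 (\<tau> x) * exp (2 * fst (g (\<tau> x)))"
      and "w2 = rational_weight M N2 (\<tau> x) * exp (2 * snd (g (\<tau> x)))"
    have "curvature (a 1) x = 4 * s * (real M ^ 2 / 2 * (w1 * w2) + real M * \<sigma> / 2 * \<epsilon> * w2)"
      unfolding curv f[OF \<tau>0] w1_def w2_def
      by (simp add: component_def source_def exp_add field_simps)
    also have "\<dots> = 2 * real M ^ 2 * (s * w1 * w2) + 4 * (real M * \<sigma> / 2) * (s * \<epsilon> * w2)"
      by (simp add: algebra_simps)
    also have "\<dots> = 8 * pi\<^sup>2 / k\<^sup>2 * (B / \<epsilon> * w2) * (B / \<epsilon> * w1 + c_squared k \<sigma>)"
      unfolding K[symmetric] s_def using \<open>\<epsilon> > 0\<close> \<open>k > 0\<close> by (simp add: field_simps power2_eq_square)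
    finally show ?thesis by (simp add: V n_def component_def w1_def w2_def)
  qed
  have sd2: "curvature (a 2) x =
     8 * pi\<^sup>2 / k\<^sup>2 * (norm (\<phi> 1 x))\<^sup>2 * ((norm (\<phi> 2 x))\<^sup>2 - c_squared k \<sigma>)" for x
  proof -
    define w1 w2 where "w1 = rational_weight M N1 (\<tau> x) * exp (2 * fst (g (\<tau> x)))"
      and "w2 = rational_weight M N2 (\<tau> x) * exp (2 * snd (g (\<tau> x)))"
    have "curvature (a 2) x = 4 * s * (real M ^ 2 / 2 * (w1 * w2) - real M * \<sigma> / 2 * \<epsilon> * w1)"
      unfolding curv f[OF \<tau>0] w1_def w2_def
      by (simp add: component_def source_def exp_add field_simps)
    also have "\<dots> = 2 * real M ^ 2 * (s * w1 * w2) - 4 * (real M * \<sigma> / 2) * (s * \<epsilon> * w1)"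
      by (simp add: algebra_simps)
    also have "\<dots> = 8 * pi\<^sup>2 / k\<^sup>2 * (B / \<epsilon> * w1) * (B / \<epsilon> * w2 - c_squared k \<sigma>)"
      unfolding K[symmetric] s_def using \<open>\<epsilon> > 0\<close> \<open>k > 0\<close> by (simp add: field_simps power2_eq_square)
    finally show ?thesis by (simp add: V n_def component_def w1_def w2_def)
  qed
  have cov: "cov_deriv (a i) 1 (\<phi> i) x - \<i> * cov_deriv (a i) 2 (\<phi> i) x = 0" for i x
  proof -
    have "cov_deriv (a i) 2 (\<phi> i) x = - \<i> * cov_deriv (a i) 1 (\<phi> i) x"
      unfolding a_def \<phi>_def by (rule cov_deriv_radial(2)[OF H HP HQ])
    then show ?thesis by simp
  qed
  have C1: "C1_on_plane (\<phi> i)" for i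
    unfolding \<phi>_def by (rule C1_radial_field[OF H HP HQ])
  have C1': "C1_on_plane (a i j)" for i j
    unfolding a_def by (rule C1_radial_potential[OF H HP HQ])
  have zero: "\<phi> i x = 0 \<longleftrightarrow> x = p" for i x
    unfolding \<phi>_def by (rule radial_field_zero_mult(1)[OF H HP HQ A n(1)])
  have mult: "has_zero_of_mult (\<phi> i) p (n i)" for i
    unfolding \<phi>_def by (rule radial_field_zero_mult(2)[OF H HP HQ A n(1)])
  have SD: "self_dual_solution k \<sigma> a \<phi>"
    unfolding self_dual_solution_def
    using sd1 sd2 cov C1 C1' by auto
  \<comment> \<open>The profile decays like \<open>\<tau>\<close> to the power
    \<open>- (M - n i)\<close>, and the correction may grow like \<open>\<tau> powr (2 * d)\<close>.
    As \<open>\<tau>\<close> is quadratic in \<open>norm (x - p)\<close>, the power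
    \<open>- \<beta>\<close> of \<open>\<tau>\<close> is the power \<open>- 2 * \<beta>\<close> of
    the distance.\<close>
  define \<beta> where "\<beta> i = real (M - n i) - 2 * d" for i
  have \<beta>: "\<beta> i \<ge> 0" for i
    using n[of i] d by (simp add: \<beta>_def)
  define C where "C i = B / \<epsilon> * 2 powr (2 * d) * s powr (- \<beta> i)" for i
  have Vle: "(norm (\<phi> i x))\<^sup>2 \<le> C i * norm (x - p) powr (- 2 * \<beta> i)" if x: "norm (x - p) \<ge> \<epsilon>" for i x
  proof -
    have xp: "norm (x - p) > 0" using x \<open>\<epsilon> > 0\<close> by linarith
    have "\<epsilon>\<^sup>2 \<le> (norm (x - p))\<^sup>2" using x \<open>\<epsilon> > 0\<close> by (intro power_mono) auto
    then have \<tau>1: "\<tau> x \<ge> 1" using \<open>\<epsilon> > 0\<close> by (simp add: \<tau>_def s_def sqdist_eq)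
    have 1: "rational_weight M (n i) (\<tau> x) \<le> \<tau> x powr (- real (M - n i))"
    proof -
      have "rational_weight M (n i) (\<tau> x) \<le> \<tau> x ^ n i / \<tau> x ^ M"
        unfolding rational_weight_def using \<tau>1 one_plus_power_pos[OF \<tau>0[of x], of M]
        by (intro divide_left_mono mult_pos_pos) auto
      also have "\<dots> = \<tau> x powr (real (n i) - real M)"
        using \<tau>1 by (simp add: powr_diff powr_realpow)
      finally show ?thesis using n(2)[of i] by (simp add: of_nat_diff)
    qed
    have "component i (g (\<tau> x)) \<le> d * ln (1 + \<tau> x)"
      using gle[OF \<tau>0, of x] abs_component_le[of i "g (\<tau> x)"] by linarith
    then have "exp (2 * component i (g (\<tau> x))) \<le> exp (2 * d * ln (1 + \<tau> x))" by simp
    also have "\<dots> = (1 + \<tau> x) powr (2 * d)" using \<tau>1 by (simp add: powr_def)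
    also have "\<dots> \<le> (2 * \<tau> x) powr (2 * d)" using \<tau>1 d by (intro powr_mono2) auto
    also have "\<dots> = 2 powr (2 * d) * \<tau> x powr (2 * d)" using \<tau>1 by (simp add: powr_mult)
    finally have 2: "exp (2 * component i (g (\<tau> x))) \<le> 2 powr (2 * d) * \<tau> x powr (2 * d)" .
    have "(norm (\<phi> i x))\<^sup>2 \<le> B / \<epsilon> * (\<tau> x powr (- real (M - n i)) * (2 powr (2 * d) * \<tau> x powr (2 * d)))"
      unfolding V using B \<open>\<epsilon> > 0\<close> by (intro mult_left_mono mult_mono 1 2) auto
    also have "\<dots> = B / \<epsilon> * 2 powr (2 * d) * \<tau> x powr (- \<beta> i)"
      by (simp add: \<beta>_def powr_add[symmetric])
    also have "\<tau> x powr (- \<beta> i) = s powr (- \<beta> i) * norm (x - p) powr (- 2 * \<beta> i)"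
      using s xp unfolding \<tau>_def sqdist_eq
      by (subst powr_mult) (auto simp: powr_powr simp flip: powr_numeral)
    finally show ?thesis by (simp add: C_def)
  qed
  have O1: "(\<lambda>x. (norm (\<phi> i x))\<^sup>2) \<in> O[at_infinity](\<lambda>x. norm x powr (- 2 * \<beta> i))" for i
    by (rule bigo_at_infinity_shift[where p = p and r = \<epsilon> and C = "C i"]) (use Vle \<beta> in auto)
  have O2: "(\<lambda>x. (norm (cov_deriv (a i) j (\<phi> i) x))\<^sup>2) \<in> O[at_infinity](\<lambda>x. norm x powr (- 2 * (\<beta> i + 1)))" for i j
  proof (rule bigo_at_infinity_shift[where p = p and r = \<epsilon> and C = "C i * (2 * real M + real (n i))\<^sup>2"])
    fix x assume x: "norm (x - p) \<ge> \<epsilon>"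
    have xp: "norm (x - p) > 0" "x \<noteq> p" using x \<open>\<epsilon> > 0\<close> by auto
    \<comment> \<open>The scale \<open>s\<close> in \<open>HP\<close> is absorbed by passing to
      \<open>\<tau>\<close>. Then \<open>t * P0 t\<close> is at most \<open>M / 2\<close> in
      absolute value, and the decay \<open>d / (1 + t)\<close> of \<open>P\<close> compensates the
      factor \<open>t\<close>.\<close>
    have "\<bar>sqdist p x * HP i (sqdist p x)\<bar> = \<tau> x * \<bar>P0 (\<tau> x) + component i (P (\<tau> x))\<bar>"
      using s by (simp add: HP_def \<tau>_def abs_mult sqdist_nonneg mult_ac)
    also have "\<dots> \<le> \<tau> x * (\<bar>P0 (\<tau> x)\<bar> + norm (P (\<tau> x)))"
      using \<tau>0 abs_component_le[of i "P (\<tau> x)"] by (intro mult_left_mono) auto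
    also have "\<dots> \<le> real M / 2 + d"
    proof -
      have "\<tau> x * \<bar>P0 (\<tau> x)\<bar> = real M / 2 * (\<tau> x ^ M / (1 + \<tau> x ^ M))"
      proof -
        have "\<bar>P0 (\<tau> x)\<bar> = real M / 2 * rational_weight M m (\<tau> x)"
          using \<tau>0 by (simp add: P0_def abs_mult rational_weight_nonneg)
        moreover have "\<tau> x * rational_weight M m (\<tau> x) = \<tau> x ^ M / (1 + \<tau> x ^ M)"
          by (simp add: rational_weight_def Mm)
        ultimately show ?thesis by (metis mult.left_commute)
      qed
      also have "\<dots> \<le> real M / 2 * 1"
        using one_plus_power_pos[OF \<tau>0[of x], of M] by (intro mult_left_mono) auto
      finally have "\<tau> x * \<bar>P0 (\<tau> x)\<bar> \<le> real M / 2" by simp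
      moreover have "\<tau> x * norm (P (\<tau> x)) \<le> \<tau> x * (d / (1 + \<tau> x))"
        using \<tau>0 by (intro mult_left_mono Ple)
      moreover have "\<tau> x * (d / (1 + \<tau> x)) \<le> d"
        using \<tau>0[of x] d by (simp add: field_simps)
      ultimately show ?thesis by (simp add: distrib_left)
    qed
    also have "\<dots> \<le> real M" using d by (simp add: M_def field_simps)
    finally have le: "2 * \<bar>sqdist p x * HP i (sqdist p x)\<bar> + real (n i) \<le> 2 * real M + real (n i)" by simp
    have "norm (cov_deriv (a i) j (\<phi> i) x) \<le>
       norm (\<phi> i x) / norm (x - p) * (2 * \<bar>sqdist p x * HP i (sqdist p x)\<bar> + real (n i))"
      unfolding a_def \<phi>_def by (rule norm_cov_deriv_radial_le[OF H HP HQ A xp(2)])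
    also have "\<dots> \<le> norm (\<phi> i x) / norm (x - p) * (2 * real M + real (n i))"
      by (intro mult_left_mono le) auto
    finally have "(norm (cov_deriv (a i) j (\<phi> i) x))\<^sup>2 \<le>
        (norm (\<phi> i x) / norm (x - p) * (2 * real M + real (n i)))\<^sup>2"
      by (intro power_mono) auto
    also have "\<dots> = (norm (\<phi> i x))\<^sup>2 * ((2 * real M + real (n i))\<^sup>2 / (norm (x - p))\<^sup>2)"
      by (simp add: power_mult_distrib power_divide)
    also have "\<dots> \<le> C i * norm (x - p) powr (- 2 * \<beta> i) * ((2 * real M + real (n i))\<^sup>2 / (norm (x - p))\<^sup>2)"
      by (intro mult_right_mono Vle x) auto
    also have "\<dots> = C i * (2 * real M + real (n i))\<^sup>2 * (norm (x - p) powr (- 2 * \<beta> i) * norm (x - p) powr (- 2))"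
      using xp by (simp add: powr_minus divide_inverse)
    also have "norm (x - p) powr (- 2 * \<beta> i) * norm (x - p) powr (- 2) = norm (x - p) powr (- 2 * (\<beta> i + 1))"
      by (simp add: powr_add[symmetric])
    finally show "\<bar>(norm (cov_deriv (a i) j (\<phi> i) x))\<^sup>2\<bar> \<le>
        C i * (2 * real M + real (n i))\<^sup>2 * norm (x - p) powr (- 2 * (\<beta> i + 1))" by simp
  qed (use \<beta>[of i] in simp)
  show ?thesis
  proof (rule exI[of _ a], rule exI[of _ \<phi>], intro conjI allI)
    show "curvature (a i) x = 1 / \<epsilon>\<^sup>2 *
        (4 * (real M ^ 2 / 2 * (rational_weight M N1 (sqdist p x / \<epsilon>\<^sup>2) * rational_weight M N2 (sqdist p x / \<epsilon>\<^sup>2))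
           - component i (f (sqdist p x / \<epsilon>\<^sup>2))))" for i x
      unfolding curv by (simp add: \<tau>_def s_def)
  qed (use SD zero mult O1 O2 in \<open>simp_all add: \<beta>_def\<close>)
qed

section \<open>Limit masses and the choice of the family\<close>

lemma weakly_tendsto_dirac_cmult:
  assumes "weakly_tendsto_dirac g m p F" "\<forall>\<^sub>F \<epsilon> in F. \<forall>x. h \<epsilon> x = c * g \<epsilon> x"
  shows "weakly_tendsto_dirac h (c * m) p F"
  unfolding weakly_tendsto_dirac_def
proof (intro allI impI)
  fix \<psi> :: "real^2 \<Rightarrow> real" assume "continuous_on UNIV \<psi> \<and> bounded (range \<psi>)"
  then have "((\<lambda>\<epsilon>. LINT x|lborel. g \<epsilon> x * \<psi> x) \<longlongrightarrow> m * \<psi> p) F"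
    using assms(1) by (auto simp: weakly_tendsto_dirac_def)
  from tendsto_mult_left[OF this, of c]
  have "((\<lambda>\<epsilon>. c * (LINT x|lborel. g \<epsilon> x * \<psi> x)) \<longlongrightarrow> c * m * \<psi> p) F"
    by (simp add: mult.assoc)
  moreover have "\<forall>\<^sub>F \<epsilon> in F. c * (LINT x|lborel. g \<epsilon> x * \<psi> x) = (LINT x|lborel. h \<epsilon> x * \<psi> x)"
    using assms(2) by eventually_elim (simp add: mult.assoc)
  ultimately show "((\<lambda>\<epsilon>. LINT x|lborel. h \<epsilon> x * \<psi> x) \<longlongrightarrow> c * m * \<psi> p) F"
    by (rule Lim_transform_eventually)
qed

text \<open>The constant 1 is an admissible test function, since boundedness and not compact support
  is asked for; this is why the fluxes converge.\<close>

lemma weakly_tendsto_dirac_mass: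
  assumes "weakly_tendsto_dirac g m p F"
  shows "((\<lambda>\<epsilon>. LINT x|lborel. g \<epsilon> x) \<longlongrightarrow> m) F"
  using assms[unfolded weakly_tendsto_dirac_def, rule_format, of "\<lambda>_. 1"] by simp

text \<open>The primitive \<open>- 2 * M / (1 + t ^ M)\<close> runs from \<open>- 2 * M\<close> to
  0, and the area factor is \<open>pi\<close>. Division by \<open>2 * pi\<close> leaves
  \<open>M\<close>, the weight of the Dirac mass.\<close>

lemma has_bochner_integral_liouville:
  fixes m :: nat and p :: "real^2"
  defines "M \<equiv> Suc m"
  shows "has_bochner_integral lborel (\<lambda>x. 2 * real M ^ 2 * (sqdist p x ^ m / (1 + sqdist p x ^ M)\<^sup>2))
           (2 * pi * real M)"
proof -
  let ?F = "\<lambda>t::real. - (2 * real M) / (1 + t ^ M)"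
  have "has_bochner_integral lborel (\<lambda>x. 2 * real M ^ 2 * (sqdist p x ^ m / (1 + sqdist p x ^ M)\<^sup>2))
           (pi * (0 - ?F 0))"
  proof (rule has_bochner_integral_radial)
    fix t :: real assume "t \<ge> 0"
    then have "1 + t ^ M > 0" by (rule one_plus_power_pos)
    moreover have "M - Suc 0 = m" by (simp add: M_def)
    ultimately show "(?F has_real_derivative 2 * real M ^ 2 * (t ^ m / (1 + t ^ M)\<^sup>2)) (at t)"
      by (auto intro!: derivative_eq_intros simp: power2_eq_square)
    show "0 \<le> 2 * real M ^ 2 * (t ^ m / (1 + t ^ M)\<^sup>2)" using \<open>t \<ge> 0\<close> by simp
  next
    have "filterlim (\<lambda>t::real. 1 + t ^ M) at_top at_top"
      by (intro filterlim_tendsto_add_at_top[OF tendsto_const] filterlim_pow_at_top filterlim_ident)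
         (simp add: M_def)
    then show "(?F \<longlongrightarrow> 0) at_top"
      by (intro tendsto_divide_0[OF tendsto_const] filterlim_at_top_imp_at_infinity)
  qed measurable
  also have "pi * (0 - ?F 0) = 2 * pi * real M" by (simp add: M_def)
  finally show ?thesis .
qed

theorem theorem1:
  fixes k \<sigma> :: real and p :: "real^2" and N N1 N2 :: nat
  assumes "k > 0" and "\<sigma> > 0" and "N \<ge> 1" and "N1 \<ge> 1" and "N2 \<ge> 1"
  shows "\<exists>\<epsilon>0>0. \<exists>(a :: real \<Rightarrow> 2 \<Rightarrow> 2 \<Rightarrow> real^2 \<Rightarrow> real) (\<phi> :: real \<Rightarrow> 2 \<Rightarrow> real^2 \<Rightarrow> complex)
             (\<beta> :: real \<Rightarrow> 2 \<Rightarrow> real).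
    (\<forall>\<epsilon>\<in>{0<..<\<epsilon>0}.
       self_dual_solution k \<sigma> (a \<epsilon>) (\<phi> \<epsilon>) \<and>
       (\<forall>i x. \<phi> \<epsilon> i x = 0 \<longleftrightarrow> x = p) \<and>
       has_zero_of_mult (\<phi> \<epsilon> 1) p N1 \<and> has_zero_of_mult (\<phi> \<epsilon> 2) p N2 \<and>
       (\<forall>i. (\<lambda>x. (norm (\<phi> \<epsilon> i x))^2) \<in> O[at_infinity](\<lambda>x. norm x powr (- 2 * \<beta> \<epsilon> i))) \<and>
       (\<forall>i j. (\<lambda>x. (norm (cov_deriv (a \<epsilon> i) j (\<phi> \<epsilon> i) x))^2)
                \<in> O[at_infinity](\<lambda>x. norm x powr (- 2 * (\<beta> \<epsilon> i + 1)))) \<and>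
       curvature (a \<epsilon> 1) \<in> O[at_infinity](\<lambda>x. norm x powr (- 2 * \<beta> \<epsilon> 2)) \<and>
       curvature (a \<epsilon> 2) \<in> O[at_infinity](\<lambda>x. norm x powr (- 2 * \<beta> \<epsilon> 1)) \<and>
       (\<forall>i. integrable lborel (curvature (a \<epsilon> i)))) \<and>
    ((\<lambda>\<epsilon>. \<beta> \<epsilon> 1) \<longlongrightarrow> real N2 + 1) (at_right 0) \<and>
    ((\<lambda>\<epsilon>. \<beta> \<epsilon> 2) \<longlongrightarrow> real N1 + 1) (at_right 0) \<and>
    (\<forall>i. weakly_tendsto_dirac (\<lambda>\<epsilon> x. curvature (a \<epsilon> i) x / (2 * pi))
           (real N1 + real N2 + 1) p (at_right 0)) \<and>
    ((\<lambda>\<epsilon>. LINT x|lborel. \<bar>curvature (a \<epsilon> 1) x - curvature (a \<epsilon> 2) x\<bar>) \<longlongrightarrow> 0) (at_right 0) \<and>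
    (\<forall>i. ((\<lambda>\<epsilon>. total_flux (a \<epsilon> i) / (2 * pi)) \<longlongrightarrow> real N1 + real N2 + 1) (at_right 0)) \<and>
    ((\<lambda>\<epsilon>. total_energy N k \<sigma> (a \<epsilon>)) \<longlongrightarrow> 0) (at_right 0)"
proof -
  define M where "M = Suc (N1 + N2)"
  define n where "n i = (if i = 1 then N1 else N2)" for i :: 2
  \<comment> \<open>The strength of the \<open>c^2\<close> term. The self-dual equations carry
    \<open>\<gamma> * \<epsilon>\<close> where \<open>radial_solution\<close> has its small
    parameter, so the latter is used at \<open>\<gamma> * \<epsilon>\<close> and its range and rate
    are rescaled.\<close>
  define \<gamma> where "\<gamma> = real M * \<sigma> / 2"
  have \<gamma>: "\<gamma> > 0" using \<open>\<sigma> > 0\<close> by (simp add: \<gamma>_def M_def)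
  define D :: "real \<Rightarrow> real" where "D t = (1 + t) powr (-5/4)" for t
  define q where "q t = rational_weight M N1 t * rational_weight M N2 t" for t
  define R where "R d \<epsilon> f g P Q t \<longleftrightarrow>
       f t = source (real M ^ 2 / 2 * (rational_weight M N1 t * rational_weight M N2 t)) (\<epsilon> * rational_weight M N1 t) (\<epsilon> * rational_weight M N2 t) (g t) \<and>
       (g has_vector_derivative P t) (at t within {0..}) \<and>
       (P has_vector_derivative Q t) (at t within {0..}) \<and>
       P t + t *\<^sub>R Q t = f t \<and>
       norm (f t) \<le> d * (1 + t) powr (-5/4) \<and>
       norm (P t) \<le> d / (1 + t) \<and>
       norm (g t) \<le> d * ln (1 + t)" for d \<epsilon> f g and P Q :: "real \<Rightarrow> real \<times> real" and t
  have "\<exists>\<eta> \<epsilon>0. \<epsilon>0 > 0 \<and> (\<eta> \<longlongrightarrow> 0) (at_right 0) \<and> (\<forall>\<epsilon>\<in>{0<..<\<epsilon>0}. 0 \<le> \<eta> \<epsilon> \<and> \<eta> \<epsilon> \<le> 1/40 \<and>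
    (\<exists>f g P Q. continuous_on {0..} f \<and> continuous_on {0..} Q \<and> (\<forall>t\<ge>0. R (\<eta> \<epsilon>) \<epsilon> f g P Q t)))"
    using radial_solution[OF \<open>N1 \<ge> 1\<close> \<open>N2 \<ge> 1\<close>] unfolding R_def M_def .
  then obtain \<eta>' \<epsilon>1 where \<epsilon>1: "\<epsilon>1 > 0" and \<eta>': "(\<eta>' \<longlongrightarrow> 0) (at_right 0)"
      "\<And>\<epsilon>. \<epsilon> \<in> {0<..<\<epsilon>1} \<Longrightarrow> 0 \<le> \<eta>' \<epsilon> \<and> \<eta>' \<epsilon> \<le> 1/40"
    and sol: "\<And>\<epsilon>. \<epsilon> \<in> {0<..<\<epsilon>1} \<Longrightarrow>
        \<exists>f g P Q. continuous_on {0..} f \<and> continuous_on {0..} Q \<and> (\<forall>t\<ge>0. R (\<eta>' \<epsilon>) \<epsilon> f g P Q t)"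
    by blast
  define \<epsilon>0 where "\<epsilon>0 = \<epsilon>1 / \<gamma>"
  have \<epsilon>0: "\<epsilon>0 > 0" using \<epsilon>1 \<gamma> by (simp add: \<epsilon>0_def)
  have dom: "\<gamma> * \<epsilon> \<in> {0<..<\<epsilon>1}" if "\<epsilon> \<in> {0<..<\<epsilon>0}" for \<epsilon>
    using that \<gamma> by (simp add: \<epsilon>0_def field_simps)
  define \<eta> where "\<eta> \<epsilon> = \<eta>' (\<gamma> * \<epsilon>)" for \<epsilon>
  have \<eta>b: "0 \<le> \<eta> \<epsilon>" "\<eta> \<epsilon> \<le> 1/40" if "\<epsilon> \<in> {0<..<\<epsilon>0}" for \<epsilon>
    using \<eta>'(2)[OF dom[OF that]] by (auto simp: \<eta>_def)
  have \<eta>: "(\<eta> \<longlongrightarrow> 0) (at_right 0)"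
  proof -
    have "((\<lambda>\<epsilon>. \<gamma> * \<epsilon>) \<longlongrightarrow> \<gamma> * 0) (at_right 0)" by (intro tendsto_intros)
    then have "filterlim (\<lambda>\<epsilon>. \<gamma> * \<epsilon>) (at_right 0) (at_right 0)"
      using \<gamma> by (auto simp: filterlim_at eventually_at_filter)
    from filterlim_compose[OF \<eta>'(1) this] show ?thesis by (simp add: \<eta>_def[abs_def])
  qed
  \<comment> \<open>Fields and rescaled densities \<open>Z\<close> are chosen together for each
    \<open>\<epsilon>\<close>, so that they belong to the same solution. The factor 4 in the last
    bound comes from the planar Laplacian in \<open>t\<close>.\<close>
  define good where "good \<epsilon> a \<phi> Z \<longleftrightarrow> self_dual_solution k \<sigma> a \<phi> \<and> (\<forall>i x. \<phi> i x = 0 \<longleftrightarrow> x = p) \<and>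
     (\<forall>i. has_zero_of_mult (\<phi> i) p (n i)) \<and>
     (\<forall>i. (\<lambda>x. (norm (\<phi> i x))\<^sup>2) \<in> O[at_infinity](\<lambda>x. norm x powr (- 2 * (real (M - n i) - 2 * \<eta> \<epsilon>)))) \<and>
     (\<forall>i j. (\<lambda>x. (norm (cov_deriv (a i) j (\<phi> i) x))\<^sup>2)
                \<in> O[at_infinity](\<lambda>x. norm x powr (- 2 * (real (M - n i) - 2 * \<eta> \<epsilon> + 1)))) \<and>
     (\<forall>i x. curvature (a i) x = 1 / \<epsilon>\<^sup>2 * Z i (sqdist p x / \<epsilon>\<^sup>2)) \<and>
     (\<forall>i. continuous_on {0..} (Z i)) \<and>
     (\<forall>i. \<forall>t\<ge>0. \<bar>Z i t - 2 * real M ^ 2 * q t\<bar> \<le> 4 * \<eta> \<epsilon> * D t)" for \<epsilon> a \<phi> and Z :: "2 \<Rightarrow> real \<Rightarrow> real"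
  have "\<exists>a \<phi> Z. good \<epsilon> a \<phi> Z" if \<epsilon>: "\<epsilon> \<in> {0<..<\<epsilon>0}" for \<epsilon>
  proof -
    obtain f g P Q where f: "continuous_on {0..} f" and Q: "continuous_on {0..} Q"
      and R: "\<And>t. t \<ge> 0 \<Longrightarrow> R (\<eta> \<epsilon>) (\<gamma> * \<epsilon>) f g P Q t"
      using sol[OF dom[OF \<epsilon>]] unfolding \<eta>_def by blast
    define Z where "Z i t = 4 * (real M ^ 2 / 2 * (rational_weight M N1 t * rational_weight M N2 t) - component i (f t))" for i t
    have "continuous_on {0..} (Z i)" for i
      unfolding Z_def[abs_def]
      by (intro continuous_intros continuous_on_rational_weight bounded_linear.continuous_on[OF bounded_linear_component f])
    moreover have "\<bar>Z i t - 2 * real M ^ 2 * q t\<bar> \<le> 4 * \<eta> \<epsilon> * D t" if "t \<ge> 0" for i t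
    proof -
      have "Z i t - 2 * real M ^ 2 * q t = - 4 * component i (f t)"
        by (simp add: Z_def q_def algebra_simps)
      moreover have "\<bar>component i (f t)\<bar> \<le> \<eta> \<epsilon> * D t"
        using R[OF that] abs_component_le[of i "f t"] unfolding R_def D_def by linarith
      ultimately show ?thesis by (simp add: abs_mult)
    qed
    moreover have "\<exists>a \<phi>. self_dual_solution k \<sigma> a \<phi> \<and> (\<forall>i x. \<phi> i x = 0 \<longleftrightarrow> x = p) \<and>
     (\<forall>i. has_zero_of_mult (\<phi> i) p (n i)) \<and>
     (\<forall>i. (\<lambda>x. (norm (\<phi> i x))\<^sup>2) \<in> O[at_infinity](\<lambda>x. norm x powr (- 2 * (real (M - n i) - 2 * \<eta> \<epsilon>)))) \<and>
     (\<forall>i j. (\<lambda>x. (norm (cov_deriv (a i) j (\<phi> i) x))\<^sup>2)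
                \<in> O[at_infinity](\<lambda>x. norm x powr (- 2 * (real (M - n i) - 2 * \<eta> \<epsilon> + 1)))) \<and>
     (\<forall>i x. curvature (a i) x = 1 / \<epsilon>\<^sup>2 * Z i (sqdist p x / \<epsilon>\<^sup>2))"
      unfolding Z_def n_def M_def
      by (rule self_dual_configuration[where g = g and P = P and Q = Q])
         (use assms \<epsilon> \<eta>b[OF \<epsilon>] Q R in \<open>auto simp: R_def \<gamma>_def M_def\<close>)
    ultimately show ?thesis unfolding good_def by blast
  qed
  then obtain a \<phi> Z where good: "\<And>\<epsilon>. \<epsilon> \<in> {0<..<\<epsilon>0} \<Longrightarrow> good \<epsilon> (a \<epsilon>) (\<phi> \<epsilon>) (Z \<epsilon>)"
    by metis
  define \<beta> where "\<beta> \<epsilon> i = real (M - n i) - 2 * \<eta> \<epsilon>" for \<epsilon> i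
  have n12: "n 1 = N1" "n 2 = N2" by (simp_all add: n_def)
  have ev: "\<forall>\<^sub>F \<epsilon> in at_right 0. \<epsilon> \<in> {0<..<\<epsilon>0}"
    by (rule eventually_at_rightI[OF _ \<epsilon>0])
  have curv: "curvature (a \<epsilon> i) = (\<lambda>x. 1 / \<epsilon>\<^sup>2 * Z \<epsilon> i (sqdist p x / \<epsilon>\<^sup>2))" if "\<epsilon> \<in> {0<..<\<epsilon>0}" for \<epsilon> i
    using good[OF that] by (auto simp: good_def)
  have SD: "curvature (a \<epsilon> 1) x = 8 * pi\<^sup>2 / k\<^sup>2 * (norm (\<phi> \<epsilon> 2 x))\<^sup>2 * ((norm (\<phi> \<epsilon> 1 x))\<^sup>2 + c_squared k \<sigma>)"
    "curvature (a \<epsilon> 2) x = 8 * pi\<^sup>2 / k\<^sup>2 * (norm (\<phi> \<epsilon> 1 x))\<^sup>2 * ((norm (\<phi> \<epsilon> 2 x))\<^sup>2 - c_squared k \<sigma>)"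
    if "\<epsilon> \<in> {0<..<\<epsilon>0}" for \<epsilon> x
    using good[OF that] unfolding good_def self_dual_solution_def by auto
  have q: "q t = t ^ (N1 + N2) / (1 + t ^ M)\<^sup>2" for t
    by (simp add: q_def rational_weight_def power_add power2_eq_square)
  have conc: "(\<epsilon> \<in> {0<..<\<epsilon>0} \<longrightarrow> integrable lborel (curvature (a \<epsilon> i))) \<and>
    weakly_tendsto_dirac (\<lambda>\<epsilon> x. 1 / \<epsilon>\<^sup>2 * Z \<epsilon> i (sqdist p x / \<epsilon>\<^sup>2)) (2 * pi * real M) p (at_right 0)" for i \<epsilon>
  proof -
    have Z: "continuous_on {0..} (Z \<epsilon> i)" "t \<ge> 0 \<Longrightarrow> \<bar>Z \<epsilon> i t - 2 * real M ^ 2 * q t\<bar> \<le> 4 * \<eta> \<epsilon> * (1 + t) powr (-5/4)"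
      if "\<epsilon> \<in> {0<..<\<epsilon>0}" for \<epsilon> t
      using good[OF that] unfolding good_def D_def by auto
    \<comment> \<open>The constant is \<open>2 * M^2\<close> times 16, one weight being at most
      \<open>4 / (1 + t)^2\<close> and the other at most 4. The exponent \<open>-2\<close> is
      weakened to the \<open>-5/4\<close> of the correction.\<close>
    have Z0: "\<bar>2 * real M ^ 2 * q t\<bar> \<le> 32 * real M ^ 2 * (1 + t) powr (-5/4)" if t: "t \<ge> 0" for t
    proof -
      have w: "rational_weight M j t \<le> 4 / (1 + t)\<^sup>2" if "j = N1 \<or> j = N2" for j
        unfolding rational_weight_def by (rule rational_weight_le[OF t]) (use that assms in \<open>auto simp: M_def\<close>)
      have "(4::real) / (1 + t)\<^sup>2 \<le> 4 / 1" using t by (intro divide_left_mono) (auto simp: one_le_power)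
      then have "q t \<le> 4 / (1 + t)\<^sup>2 * 4"
        unfolding q_def using t by (intro mult_mono order_trans[OF w] w rational_weight_nonneg) auto
      also have "\<dots> = 16 * (1 + t) powr (-2)" using t by (simp add: powr_minus divide_inverse)
      also have "\<dots> \<le> 16 * (1 + t) powr (-5/4)" using t by (intro mult_left_mono powr_mono) auto
      finally have "2 * real M ^ 2 * q t \<le> 2 * real M ^ 2 * (16 * (1 + t) powr (-5/4))"
        by (intro mult_left_mono) auto
      then show ?thesis using t by (simp add: q_def rational_weight_nonneg)
    qed
    have int: "has_bochner_integral lborel (\<lambda>y. 2 * real M ^ 2 * q (sqdist (0::real^2) y)) (2 * pi * real M)"
      unfolding q using has_bochner_integral_liouville[of "N1 + N2" 0] by (simp only: M_def)
    have \<eta>4: "((\<lambda>\<epsilon>. 4 * \<eta> \<epsilon>) \<longlongrightarrow> 0) (at_right 0)" using tendsto_mult_left[OF \<eta>, of 4] by simp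
    have "4 * \<eta> \<epsilon> \<le> 1" if "\<epsilon> \<in> {0<..<\<epsilon>0}" for \<epsilon> using \<eta>b[OF that] by simp
    note C = concentration[where Z = "\<lambda>\<epsilon>. Z \<epsilon> i" and p = p, OF \<epsilon>0 Z(1) Z(2) \<eta>4 this Z0 int]
    show ?thesis
    proof
      show "\<epsilon> \<in> {0<..<\<epsilon>0} \<longrightarrow> integrable lborel (curvature (a \<epsilon> i))"
      proof
        assume \<epsilon>: "\<epsilon> \<in> {0<..<\<epsilon>0}"
        show "integrable lborel (curvature (a \<epsilon> i))" unfolding curv[OF \<epsilon>] by (rule C(1)) (use \<epsilon> in auto)
      qed
      show "weakly_tendsto_dirac (\<lambda>\<epsilon> x. 1 / \<epsilon>\<^sup>2 * Z \<epsilon> i (sqdist p x / \<epsilon>\<^sup>2)) (2 * pi * real M) p (at_right 0)"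
        by (rule C(2))
    qed
  qed
  then have int: "integrable lborel (curvature (a \<epsilon> i))" if "\<epsilon> \<in> {0<..<\<epsilon>0}" for \<epsilon> i
    using that by blast
  have "weakly_tendsto_dirac (\<lambda>\<epsilon> x. curvature (a \<epsilon> i) x / (2 * pi)) (1 / (2 * pi) * (2 * pi * real M)) p (at_right 0)" for i
    by (rule weakly_tendsto_dirac_cmult[OF conc[THEN conjunct2, of i]])
       (use ev in \<open>auto elim!: eventually_mono simp: curv\<close>)
  then have weak: "weakly_tendsto_dirac (\<lambda>\<epsilon> x. curvature (a \<epsilon> i) x / (2 * pi)) (real N1 + real N2 + 1) p (at_right 0)" for i
    by (simp add: M_def add.commute add.left_commute)
  have flux: "((\<lambda>\<epsilon>. total_flux (a \<epsilon> i) / (2 * pi)) \<longlongrightarrow> real N1 + real N2 + 1) (at_right 0)" for i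
    using weakly_tendsto_dirac_mass[OF weak[of i]] by (simp add: total_flux_def)
  have "((\<lambda>\<epsilon>. 2 * pi * (total_flux (a \<epsilon> 1) / (2 * pi) - total_flux (a \<epsilon> 2) / (2 * pi))) \<longlongrightarrow>
     2 * pi * ((real N1 + real N2 + 1) - (real N1 + real N2 + 1))) (at_right 0)"
    by (intro tendsto_intros flux)
  then have "((\<lambda>\<epsilon>. total_flux (a \<epsilon> 1) - total_flux (a \<epsilon> 2)) \<longlongrightarrow> 0) (at_right 0)"
    by (simp flip: diff_divide_distrib)
  moreover have "\<forall>\<^sub>F \<epsilon> in at_right 0. total_flux (a \<epsilon> 1) - total_flux (a \<epsilon> 2) =
      (LINT x|lborel. curvature (a \<epsilon> 1) x - curvature (a \<epsilon> 2) x)"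
    using ev by eventually_elim (simp add: total_flux_def int)
  ultimately have diff: "((\<lambda>\<epsilon>. LINT x|lborel. curvature (a \<epsilon> 1) x - curvature (a \<epsilon> 2) x) \<longlongrightarrow> 0) (at_right 0)"
    by (rule Lim_transform_eventually)
  have L1: "((\<lambda>\<epsilon>. LINT x|lborel. \<bar>curvature (a \<epsilon> 1) x - curvature (a \<epsilon> 2) x\<bar>) \<longlongrightarrow> 0) (at_right 0)"
  proof (rule Lim_transform_eventually[OF diff])
    have "curvature (a \<epsilon> 1) x - curvature (a \<epsilon> 2) x \<ge> 0" if "\<epsilon> \<in> {0<..<\<epsilon>0}" for \<epsilon> x
    proof -
      have "curvature (a \<epsilon> 1) x - curvature (a \<epsilon> 2) x =
        8 * pi\<^sup>2 / k\<^sup>2 * c_squared k \<sigma> * ((norm (\<phi> \<epsilon> 1 x))\<^sup>2 + (norm (\<phi> \<epsilon> 2 x))\<^sup>2)"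
        unfolding SD[OF that] by (simp add: algebra_simps add_divide_distrib diff_divide_distrib)
      then show ?thesis using assms by (simp add: c_squared_def)
    qed
    then show "\<forall>\<^sub>F \<epsilon> in at_right 0. (LINT x|lborel. curvature (a \<epsilon> 1) x - curvature (a \<epsilon> 2) x) =
        (LINT x|lborel. \<bar>curvature (a \<epsilon> 1) x - curvature (a \<epsilon> 2) x\<bar>)"
      using ev by (auto elim!: eventually_mono)
  qed
  have energy: "((\<lambda>\<epsilon>. total_energy N k \<sigma> (a \<epsilon>)) \<longlongrightarrow> 0) (at_right 0)"
    unfolding total_energy_def by (rule tendsto_mult_right_zero[OF diff])
  have "((\<lambda>\<epsilon>. \<beta> \<epsilon> i) \<longlongrightarrow> real (M - n i) - 2 * 0) (at_right 0)" for i
    unfolding \<beta>_def by (intro tendsto_intros \<eta>)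
  from this[of 1] this[of 2] have \<beta>lim: "((\<lambda>\<epsilon>. \<beta> \<epsilon> 1) \<longlongrightarrow> real N2 + 1) (at_right 0)"
    "((\<lambda>\<epsilon>. \<beta> \<epsilon> 2) \<longlongrightarrow> real N1 + 1) (at_right 0)"
    by (simp_all add: n12 M_def add.commute)
  have \<phi>O: "(\<lambda>x. (norm (\<phi> \<epsilon> i x))\<^sup>2) \<in> O[at_infinity](\<lambda>x. norm x powr (- 2 * \<beta> \<epsilon> i))"
    if "\<epsilon> \<in> {0<..<\<epsilon>0}" for \<epsilon> i
    using good[OF that] by (simp add: good_def \<beta>_def)
  have \<beta>0: "\<beta> \<epsilon> i \<ge> 0" if "\<epsilon> \<in> {0<..<\<epsilon>0}" for \<epsilon> i
    using \<eta>b[OF that] by (simp add: \<beta>_def n_def M_def)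
  \<comment> \<open>In the curvature equations the factor containing \<open>c^2\<close> does not
    tend to zero, so boundedness is all that it contributes.\<close>
  have \<phi>O1: "(\<lambda>x. (norm (\<phi> \<epsilon> i x))\<^sup>2) \<in> O[at_infinity](\<lambda>_. 1)" if "\<epsilon> \<in> {0<..<\<epsilon>0}" for \<epsilon> i
  proof (rule landau_o.big_trans[OF \<phi>O[OF that]], rule bigoI[where c = 1])
    have "\<forall>\<^sub>F x in at_infinity. norm (x::real^2) \<ge> 1" by (auto simp: eventually_at_infinity)
    then show "\<forall>\<^sub>F x in at_infinity. norm (norm (x::real^2) powr (- 2 * \<beta> \<epsilon> i)) \<le> 1 * norm (1::real)"
    proof eventually_elim
      case (elim x)
      then show ?case using powr_mono[of "- 2 * \<beta> \<epsilon> i" 0 "norm x"] \<beta>0[OF that, of i]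
        by (auto split: if_splits)
    qed
  qed
  have cO1: "curvature (a \<epsilon> 1) \<in> O[at_infinity](\<lambda>x. norm x powr (- 2 * \<beta> \<epsilon> 2))"
    and cO2: "curvature (a \<epsilon> 2) \<in> O[at_infinity](\<lambda>x. norm x powr (- 2 * \<beta> \<epsilon> 1))" if \<epsilon>: "\<epsilon> \<in> {0<..<\<epsilon>0}" for \<epsilon>
  proof -
    have bd: "(\<lambda>x. (norm (\<phi> \<epsilon> i x))\<^sup>2 + c) \<in> O[at_infinity](\<lambda>_. 1)" for i c
      by (intro sum_in_bigo \<phi>O1[OF \<epsilon>]) simp
    have "(\<lambda>x. 8 * pi\<^sup>2 / k\<^sup>2 * (norm (\<phi> \<epsilon> i x))\<^sup>2 * ((norm (\<phi> \<epsilon> j x))\<^sup>2 + c))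
        \<in> O[at_infinity](\<lambda>x. norm x powr (- 2 * \<beta> \<epsilon> i) * 1)" for i j c
      by (rule landau_o.big.mult[OF _ bd], subst landau_o.big.cmult_in_iff)
         (use \<phi>O[OF \<epsilon>, of i] \<open>k > 0\<close> in simp_all)
    from this[of 2 1 "c_squared k \<sigma>"] this[of 1 2 "- c_squared k \<sigma>"]
    show "curvature (a \<epsilon> 1) \<in> O[at_infinity](\<lambda>x. norm x powr (- 2 * \<beta> \<epsilon> 2))"
      "curvature (a \<epsilon> 2) \<in> O[at_infinity](\<lambda>x. norm x powr (- 2 * \<beta> \<epsilon> 1))"
      by (simp_all add: SD[OF \<epsilon>, abs_def])
  qed
  show ?thesis
  proof (rule exI[of _ \<epsilon>0], rule conjI[OF \<epsilon>0], rule exI[of _ a], rule exI[of _ \<phi>], rule exI[of _ \<beta>],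
      intro conjI ballI)
    fix \<epsilon> assume \<epsilon>: "\<epsilon> \<in> {0<..<\<epsilon>0}"
    show "has_zero_of_mult (\<phi> \<epsilon> 1) p N1" "has_zero_of_mult (\<phi> \<epsilon> 2) p N2"
      using good[OF \<epsilon>] unfolding good_def n12[symmetric] by blast+
    show "self_dual_solution k \<sigma> (a \<epsilon>) (\<phi> \<epsilon>)" "\<forall>i x. \<phi> \<epsilon> i x = 0 \<longleftrightarrow> x = p"
      "\<forall>i j. (\<lambda>x. (norm (cov_deriv (a \<epsilon> i) j (\<phi> \<epsilon> i) x))^2)
                \<in> O[at_infinity](\<lambda>x. norm x powr (- 2 * (\<beta> \<epsilon> i + 1)))"
      using good[OF \<epsilon>] unfolding good_def \<beta>_def by blast+
  qed (use \<phi>O cO1 cO2 int \<beta>lim weak L1 flux energy in blast)+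
qed

end
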